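(* Let $(M,Q)$ be a random vector with $\mathbb{P}(M\ge0,\,Q\ge0)=1$. Assume that $$k(x)=-\log\mathbb{P}(Q>x)\in\mathcal{R}_\alpha,\qquad f(x)=-x\log\mathbb{P}(M\ge1-1/x)\in\mathcal{R}_r\qquad\text{with }\alpha,r>1.$$ Let $r^\ast$ and $\beta$ denote the conjugate numbers to $r$ and $\alpha$, respectively (i.e. $1/r+1/r^\ast=1$, $1/\alpha+1/\beta=1$), and let $\gamma=\beta r^\ast/(\beta r^\ast-1)$. Let $R$ be the perpetuity generated by $(M,Q)$ and let $$h_{ind}(x):=\inf_{t\ge1}\left\{-t\log\left[\mathbb{P}\left(\frac1{1-M}>t\right)\mathbb{P}\left(Q>\frac xt\right)\right]\right\}.$$ (i) If $(M,Q)$ is negatively quadrant dependent, then $$\limsup_{x\to\infty}\frac{\log\mathbb{P}(R>x)}{h_{ind}(x)}\le-\left(\frac{\gamma}{\gamma-1}\right)^{\gamma-1}.$$ (ii) If $(M,Q)$ is positively quadrant dependent, then $$-\left(\frac{\gamma}{\gamma-1}\right)^{\gamma-1}\le\liminf_{x\to\infty}\frac{\log\mathbb{P}(R>x)}{h_{ind}(x)}\le\limsup_{x\to\infty}\frac{\log\mathbb{P}(R>x)}{h_{ind}(x)}\le-\frac{\alpha-1}{\alpha+r-1}\left(\frac{r}{\alpha-1}\right)^{r/(\alpha+r-1)}\left(\frac{\gamma}{\gamma-1}\right)^{\gamma-1}.$$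
   Context: Regular variation: for $\rho\in\mathbb{R}$, $\mathcal{R}_\rho$ is the class of positive measurable functions $g$ defined in a neighbourhood of $+\infty$ with $\lim_{x\to\infty}g(tx)/g(x)=t^\rho$ for all $t>0$. Quadrant dependence: a pair $(X,Y)$ is positively quadrant dependent if $\mathbb{P}(X\le x,Y\le y)\ge\mathbb{P}(X\le x)\mathbb{P}(Y\le y)$ for all $x,y\in\mathbb{R}$, and negatively quadrant dependent if this holds with the inequality reversed. Perpetuity: the perpetuity $R$ generated by $(M,Q)$ is the (unique in law) random variable satisfying $R\stackrel{d}{=}MR+Q$ with $R$ and $(M,Q)$ independent on the right-hand side; equivalently $R\stackrel{d}{=}\sum_{j=1}^\infty Q_j\prod_{k=1}^{j-1}M_k$, where $(M_n,Q_n)_{n\ge1}$ are i.i.d. copies of $(M,Q)$. *)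

theory Defs
  imports "HOL-Probability.Probability"
begin

text \<open>Positive measurable functions near \<open>+\<infinity>\<close>, regularly varying with index \<open>\<rho>\<close>.
  Values of \<open>g\<close> left of \<open>x0\<close> are irrelevant.\<close>

definition regularly_varying :: "real \<Rightarrow> (real \<Rightarrow> real) \<Rightarrow> bool" where
  "regularly_varying \<rho> g \<longleftrightarrow>
     (\<exists>x0. (\<forall>x\<ge>x0. g x > 0) \<and> g \<in> borel_measurable (restrict_space borel {x0..})) \<and>
     (\<forall>t>0. ((\<lambda>x. g (t * x) / g x) \<longlongrightarrow> t powr \<rho>) at_top)"

definition pos_quadrant_dependent :: "'a measure \<Rightarrow> ('a \<Rightarrow> real) \<Rightarrow> ('a \<Rightarrow> real) \<Rightarrow> bool" where
  "pos_quadrant_dependent P X Y \<longleftrightarrow>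
     (\<forall>x y. \<P>(\<omega> in P. X \<omega> \<le> x \<and> Y \<omega> \<le> y) \<ge> \<P>(\<omega> in P. X \<omega> \<le> x) * \<P>(\<omega> in P. Y \<omega> \<le> y))"

definition neg_quadrant_dependent :: "'a measure \<Rightarrow> ('a \<Rightarrow> real) \<Rightarrow> ('a \<Rightarrow> real) \<Rightarrow> bool" where
  "neg_quadrant_dependent P X Y \<longleftrightarrow>
     (\<forall>x y. \<P>(\<omega> in P. X \<omega> \<le> x \<and> Y \<omega> \<le> y) \<le> \<P>(\<omega> in P. X \<omega> \<le> x) * \<P>(\<omega> in P. Y \<omega> \<le> y))"

text \<open>\<open>R\<close> (on its own probability space \<open>N\<close>) is a perpetuity generated by \<open>(M, Q)\<close> (on \<open>P\<close>):
  \<open>R\<close> has the same law as \<open>M R + Q\<close>, where on the right-hand side \<open>R\<close> and \<open>(M, Q)\<close> are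
  independent. The independence is realised by taking the product space of \<open>P\<close> and \<open>N\<close>.\<close>

definition perpetuity ::
    "'a measure \<Rightarrow> ('a \<Rightarrow> real) \<Rightarrow> ('a \<Rightarrow> real) \<Rightarrow> 'b measure \<Rightarrow> ('b \<Rightarrow> real) \<Rightarrow> bool" where
  "perpetuity P M Q N R \<longleftrightarrow>
     prob_space N \<and> R \<in> borel_measurable N \<and>
     distr N borel R = distr (P \<Otimes>\<^sub>M N) borel (\<lambda>(\<omega>, \<eta>). M \<omega> * R \<eta> + Q \<omega>)"

text \<open>The infimum is taken in the reals. If \<open>- ln \<P>(Q > x)\<close> and \<open>- x ln \<P>(M \<ge> 1 - 1/x)\<close> are
  positive for all large \<open>x\<close>, then (as \<open>ln 0 = 0\<close> in HOL) those probabilities are nonzero for all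
  large \<open>x\<close>. If moreover \<open>\<P>(M \<ge> 1) = 0\<close>, which regular variation of the second function with
  index \<open>> 1\<close> forces, then both probabilities below are nonzero for every \<open>t \<ge> 1\<close>, so the
  logarithm is a genuine one and the infimum is over a nonempty set of nonnegative numbers;
  also \<open>1 / (1 - M)\<close> is then almost surely defined, and the convention \<open>1 / 0 = 0\<close> plays no role.\<close>

definition h_ind :: "'a measure \<Rightarrow> ('a \<Rightarrow> real) \<Rightarrow> ('a \<Rightarrow> real) \<Rightarrow> real \<Rightarrow> real" where
  "h_ind P M Q x =
     (INF t\<in>{1..}. - t * ln (\<P>(\<omega> in P. 1 / (1 - M \<omega>) > t) * \<P>(\<omega> in P. Q \<omega> > x / t)))"

end

theory Submission
  imports Defs "HOL-Real_Asymp.Real_Asymp"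
begin

text \<open>
  Write \<open>m t = - ln P (1 / (1 - M) > t)\<close>, \<open>k q = - ln P (Q > q)\<close> and \<open>h x = inf {t * (m t + k (x / t)) | t \<ge> 1}\<close>, which is
  \<open>h_ind\<close>. These functions vary regularly with the indices \<open>r - 1\<close>, \<open>\<alpha>\<close> and \<open>\<gamma> = \<alpha> * r / (\<alpha> + r - 1)\<close>.

  The perpetuity is the stationary law of the chain \<open>y \<mapsto> M * y + Q\<close>, and a large value of it is reached by the
  cheapest way of climbing. A step with \<open>M = 1 - 1 / t\<close> and \<open>Q = q\<close> costs \<open>m t + k q\<close> (for independent \<open>M\<close> and \<open>Q\<close>) and gains
  \<open>q - y / t = (x - y) / t\<close>, where \<open>x = t * q\<close>. By the definition of \<open>h\<close> the cost is at least \<open>h x / t\<close>, with near equality for a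
  good choice of \<open>t\<close>. So the least price of a unit of growth at level \<open>y\<close> is
  \<open>p y = inf {h x / (x - y) | x > y}\<close>, and climbing from \<open>0\<close> to \<open>x\<close> costs \<open>V x\<close>, the integral of \<open>p\<close> over \<open>{0..x}\<close>. As \<open>h\<close> behaves like
  a power with exponent \<open>\<gamma>\<close>, minimizing \<open>u powr \<gamma> / (u - 1)\<close> gives
  \<open>p y \<sim> \<gamma> * (\<gamma> / (\<gamma> - 1)) powr (\<gamma> - 1) * h y / y\<close> (\<open>tangent_slope_asymp\<close>), and Karamata's theorem gives
  \<open>V \<sim> (\<gamma> / (\<gamma> - 1)) powr (\<gamma> - 1) * h\<close> (\<open>V_asymp\<close>), where the constant of the theorem appears.

  Upper bounds: \<open>exp ((1 - e) * V)\<close> is a Lyapunov function (\<open>drift_to_half\<close>), because the gain of a random step, times \<open>p y\<close>,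
  is at most \<open>Z = m (1 / (1 - M)) + k Q\<close> (\<open>slope_times_gain_le_cost\<close>), and \<open>Z\<close> has exponential moments of all orders
  below 1. Stationarity turns the drift condition into \<open>P (R > x) \<le> c * exp (- (1 - e) * V x)\<close> (\<open>perpetuity_lyapunov_bound\<close>).
  The exponential moments are where dependence enters: under negative quadrant dependence they are bounded
  by products of marginal moments. For any dependence they exist if \<open>m\<close> and \<open>k\<close> are replaced by \<open>a * m\<close> and \<open>b * k\<close> with
  \<open>a + b = 1\<close>; this multiplies \<open>h\<close> asymptotically by a constant (\<open>cost_le_weighted_cost\<close> is the inequality
  needed), and the best weights give the extra factor in the positively dependent case.

  Lower bound: under positive quadrant dependence a step \<open>M > 1 - 1 / t\<close>, \<open>Q > q\<close> has probability at least
  \<open>exp (- (m t + k q))\<close>, and a chain of nearly optimal steps (\<open>efficient_step\<close>, \<open>cost_upper_bound_by_steps\<close>) leads from a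
  fixed level to \<open>x\<close> at a cost of about \<open>V x\<close>.
\<close>

section \<open>Regular variation of monotone functions\<close>

text \<open>Only the limit relation of regular variation is recorded here. It will be applied to functions that
  are monotone and nonnegative on the whole line, where measurability and eventual positivity follow.\<close>

definition varies_with_index :: "real \<Rightarrow> (real \<Rightarrow> real) \<Rightarrow> bool" where
  "varies_with_index \<rho> g \<longleftrightarrow> (\<forall>t>0. ((\<lambda>x. g (t * x) / g x) \<longlongrightarrow> t powr \<rho>) at_top)"

lemma varies_with_indexD:
  "varies_with_index \<rho> g \<Longrightarrow> t > 0 \<Longrightarrow> ((\<lambda>x. g (t * x) / g x) \<longlongrightarrow> t powr \<rho>) at_top"
  by (simp add: varies_with_index_def)

lemma index_eventually_pos:
  assumes "varies_with_index \<rho> g" "\<And>x. g x \<ge> 0"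
  shows "\<forall>\<^sub>F x in at_top. g x > 0"
proof -
  have "((\<lambda>x. g (1 * x) / g x) \<longlongrightarrow> 1 powr \<rho>) at_top"
    using assms(1) by (rule varies_with_indexD) simp
  then have "\<forall>\<^sub>F x in at_top. g (1 * x) / g x > 1/2"
    by (rule order_tendstoD) simp
  then show ?thesis
    by eventually_elim (use assms(2) in \<open>auto simp: less_le split: if_splits\<close>)
qed

lemma index_eventually_le:
  assumes "varies_with_index \<rho> g" "\<And>x. g x \<ge> 0" "t > 0" "t powr \<rho> < A"
  shows "\<forall>\<^sub>F x in at_top. g (t * x) \<le> A * g x"
proof -
  have "\<forall>\<^sub>F x in at_top. g (t * x) / g x < A"
    using varies_with_indexD[OF assms(1,3)] assms(4) by (rule order_tendstoD)
  with index_eventually_pos[OF assms(1,2)] show ?thesis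
    by eventually_elim (simp add: field_simps)
qed

lemma index_eventually_ge:
  assumes "varies_with_index \<rho> g" "\<And>x. g x \<ge> 0" "t > 0" "A < t powr \<rho>"
  shows "\<forall>\<^sub>F x in at_top. A * g x \<le> g (t * x)"
proof -
  have "\<forall>\<^sub>F x in at_top. A < g (t * x) / g x"
    using varies_with_indexD[OF assms(1,3)] assms(4) by (rule order_tendstoD)
  with index_eventually_pos[OF assms(1,2)] show ?thesis
    by eventually_elim (simp add: field_simps)
qed

lemma index_cmult:
  assumes "varies_with_index \<rho> g" "c > 0"
  shows "varies_with_index \<rho> (\<lambda>x. c * g x)"
  using assms by (simp add: varies_with_index_def)

text \<open>A step by a factor \<open>l > 1\<close> multiplies \<open>g\<close> by at least \<open>l powr s\<close> once the argument is large. Iterating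
  such steps gives the bound along \<open>l ^ n * y\<close>, monotonicity fills the gaps, and what is lost in a gap is
  a factor \<open>l powr s\<close>, which is as close to 1 as desired when \<open>l\<close> is close to 1.\<close>

lemma Potter_lower:
  fixes g :: "real \<Rightarrow> real"
  assumes vr: "varies_with_index \<rho> g" and nn: "\<And>x. g x \<ge> 0" and mono: "mono g"
    and s: "0 < s" "s < \<rho>" and C: "C < 1"
  obtains Y where "Y > 0" "\<And>x y. Y \<le> y \<Longrightarrow> y \<le> x \<Longrightarrow> C * (x / y) powr s * g y \<le> g x"
proof -
  have "((\<lambda>l::real. l powr (-s)) \<longlongrightarrow> 1 powr (-s)) (at_right 1)"
    by (intro tendsto_intros) auto
  then have "\<forall>\<^sub>F l::real in at_right 1. l powr (-s) > C"
    using C by (intro order_tendstoD) auto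
  moreover have "\<forall>\<^sub>F l::real in at_right 1. l > 1"
    by (simp add: eventually_at_filter)
  ultimately have "\<forall>\<^sub>F l::real in at_right 1. l > 1 \<and> l powr (-s) > C"
    by eventually_elim auto
  then obtain l :: real where l: "l > 1" "l powr (-s) > C"
    using eventually_happens'[OF trivial_limit_at_right_real] by blast
  have "\<forall>\<^sub>F x in at_top. l powr s * g x \<le> g (l * x)"
    using l s by (intro index_eventually_ge[OF vr nn]) auto
  then obtain Y0 where Y0: "\<And>x. x \<ge> Y0 \<Longrightarrow> l powr s * g x \<le> g (l * x)"
    by (auto simp: eventually_at_top_linorder)
  define Y where "Y = max 1 Y0"
  have iter: "(l powr s) ^ n * g y \<le> g (l ^ n * y)" if "y \<ge> Y" for y n
  proof (induction n)
    case (Suc n)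
    have "(l powr s) ^ Suc n * g y = l powr s * ((l powr s) ^ n * g y)" by simp
    also have "\<dots> \<le> l powr s * g (l ^ n * y)" using Suc by (intro mult_left_mono) auto
    also have "\<dots> \<le> g (l * (l ^ n * y))"
    proof (rule Y0)
      have "1 * y \<le> l ^ n * y" using l that by (intro mult_right_mono one_le_power) (auto simp: Y_def)
      then show "Y0 \<le> l ^ n * y" using that unfolding Y_def by linarith
    qed
    finally show ?case by (simp add: mult_ac)
  qed auto
  show ?thesis
  proof
    show "Y > 0" by (simp add: Y_def)
    fix x y assume xy: "Y \<le> y" "y \<le> x"
    then have pos: "y > 0" "x > 0" by (auto simp: Y_def)
    define n where "n = nat \<lfloor>log l (x / y)\<rfloor>"
    have lg: "log l (x / y) \<ge> 0" using l xy pos by simp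
    have n1: "real n \<le> log l (x / y)" "log l (x / y) \<le> real n + 1"
      using lg unfolding n_def by linarith+
    have xe: "x / y = l powr log l (x / y)" using l pos by simp
    have "l ^ n = l powr real n" using l by (simp add: powr_realpow)
    also have "\<dots> \<le> x / y" using n1(1) l by (subst xe, intro powr_mono) auto
    finally have le: "l ^ n * y \<le> x" using pos by (simp add: field_simps)
    have "x / y \<le> l powr (real n + 1)" using n1(2) l by (subst xe, intro powr_mono) auto
    then have "(x / y) powr s \<le> (l powr (real n + 1)) powr s"
      using s pos by (intro powr_mono2) auto
    also have "\<dots> = (l powr s) ^ n * l powr s"
      using l by (simp add: powr_powr powr_realpow[symmetric] powr_add[symmetric] algebra_simps)
    finally have A: "(x / y) powr s \<le> (l powr s) ^ n * l powr s" .
    have "C * (x / y) powr s \<le> l powr (-s) * (x / y) powr s"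
      using l by (intro mult_right_mono) auto
    also have "\<dots> \<le> l powr (-s) * ((l powr s) ^ n * l powr s)"
      using A by (intro mult_left_mono) auto
    also have "\<dots> = (l powr s) ^ n" using l by (simp add: powr_minus)
    finally have "C * (x / y) powr s * g y \<le> (l powr s) ^ n * g y"
      using nn by (intro mult_right_mono)
    also have "\<dots> \<le> g (l ^ n * y)" by (rule iter[OF xy(1)])
    also have "\<dots> \<le> g x" using mono le by (rule monoD)
    finally show "C * (x / y) powr s * g y \<le> g x" .
  qed
qed

lemma index_power_growth:
  fixes g :: "real \<Rightarrow> real"
  assumes vr: "varies_with_index \<rho> g" and nn: "\<And>x. g x \<ge> 0" and mono: "mono g"
    and s: "0 < s" "s < \<rho>"
  obtains c where "c > 0" "\<forall>\<^sub>F x in at_top. c * x powr s \<le> g x"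
proof -
  obtain Y where Y: "Y > 0" "\<And>x y. Y \<le> y \<Longrightarrow> y \<le> x \<Longrightarrow> 1/2 * (x / y) powr s * g y \<le> g x"
    by (rule Potter_lower[OF vr nn mono s, of "1/2"]) auto
  have "\<forall>\<^sub>F y in at_top. g y > 0 \<and> y \<ge> Y"
    using index_eventually_pos[OF vr nn] eventually_ge_at_top[of Y] by eventually_elim auto
  then obtain y where y: "g y > 0" "y \<ge> Y"
    using eventually_happens'[OF trivial_limit_at_top_linorder] by blast
  show ?thesis
  proof
    show "1/2 * y powr (-s) * g y > 0" using y Y by simp
    show "\<forall>\<^sub>F x in at_top. 1/2 * y powr (-s) * g y * x powr s \<le> g x"
      using eventually_ge_at_top[of y]
    proof eventually_elim
      case (elim x)
      have "(x / y) powr s = x powr s * y powr (-s)"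
        by (simp only: powr_divide powr_minus_divide)  simp
      then show ?case using Y(2)[OF y(2) elim] by (simp add: mult_ac)
    qed
  qed
qed

lemma index_at_top:
  fixes g :: "real \<Rightarrow> real"
  assumes "varies_with_index \<rho> g" "\<And>x. g x \<ge> 0" "mono g" "\<rho> > 0"
  shows "filterlim g at_top at_top"
proof -
  obtain c where c: "c > 0" "\<forall>\<^sub>F x in at_top. c * x powr (\<rho>/2) \<le> g x"
    using assms by (auto intro: index_power_growth[of \<rho> g "\<rho>/2"])
  have "filterlim (\<lambda>x::real. c * x powr (\<rho>/2)) at_top at_top"
    using c assms(4) by real_asymp
  then show ?thesis using c(2) by (rule filterlim_at_top_mono)
qed

lemma index_dominates_ln:
  fixes g :: "real \<Rightarrow> real"
  assumes "varies_with_index \<rho> g" "\<And>x. g x \<ge> 0" "mono g" "\<rho> > 0"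
  shows "\<forall>\<^sub>F x in at_top. K * ln x \<le> g x"
proof -
  obtain c where c: "c > 0" "\<forall>\<^sub>F x in at_top. c * x powr (\<rho>/2) \<le> g x"
    using assms by (auto intro: index_power_growth[of \<rho> g "\<rho>/2"])
  have "((\<lambda>x::real. K * ln x / (c * x powr (\<rho>/2))) \<longlongrightarrow> 0) at_top"
    using c assms(4) by real_asymp
  then have "\<forall>\<^sub>F x::real in at_top. K * ln x / (c * x powr (\<rho>/2)) < 1"
    by (rule order_tendstoD) simp
  with c(2) eventually_gt_at_top[of 0] show ?thesis
    by eventually_elim (use c in \<open>auto simp: field_simps\<close>)
qed

text \<open>The bounds force \<open>f / g\<close> to tend to 1. This serves to replace \<open>M \<ge> 1 - 1 / x\<close> by the strict inequality: the two tail
  costs interlace up to a factor \<open>c > 1\<close> in the argument.\<close>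

lemma index_squeeze:
  assumes vr: "varies_with_index \<rho> g" and nn: "\<And>x. g x \<ge> 0"
    and le: "\<forall>\<^sub>F x in at_top. g x \<le> f x"
    and ge: "\<And>c. c > 1 \<Longrightarrow> \<forall>\<^sub>F x in at_top. f x \<le> g (c * x)"
  shows "varies_with_index \<rho> f"
proof -
  have gpos: "\<forall>\<^sub>F x in at_top. g x > 0" by (rule index_eventually_pos[OF vr nn])
  have ratio: "((\<lambda>x. f x / g x) \<longlongrightarrow> 1) at_top"
  proof (rule order_tendstoI)
    fix A :: real assume "A < 1"
    from le gpos show "\<forall>\<^sub>F x in at_top. A < f x / g x"
    proof eventually_elim
      case (elim x)
      then have "1 \<le> f x / g x" by simp
      then show ?case using \<open>A < 1\<close> by simp
    qed
  next
    fix A :: real assume A: "1 < A"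
    have "((\<lambda>c. c powr \<rho>) \<longlongrightarrow> 1 powr \<rho>) (at_right (1::real))"
      by (intro tendsto_intros) auto
    then have "\<forall>\<^sub>F c::real in at_right 1. c powr \<rho> < A"
      using A by (intro order_tendstoD) auto
    moreover have "\<forall>\<^sub>F c::real in at_right 1. c > 1" by (simp add: eventually_at_filter)
    ultimately have "\<forall>\<^sub>F c::real in at_right 1. c powr \<rho> < A \<and> c > 1" by eventually_elim auto
    then obtain c :: real where c: "c powr \<rho> < A" "c > 1"
      using eventually_happens'[OF trivial_limit_at_right_real] by blast
    have "\<forall>\<^sub>F x in at_top. g (c * x) / g x < A"
      using varies_with_indexD[OF vr, of c] c by (intro order_tendstoD) auto
    with ge[OF c(2)] gpos show "\<forall>\<^sub>F x in at_top. f x / g x < A"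
      by eventually_elim (simp add: field_simps)
  qed
  show ?thesis
    unfolding varies_with_index_def
  proof (intro allI impI)
    fix t :: real assume t: "t > 0"
    have fl: "filterlim (\<lambda>x. t * x) at_top at_top" using t by real_asymp
    have "((\<lambda>x. (f (t * x) / g (t * x)) * (g (t * x) / g x) / (f x / g x)) \<longlongrightarrow> 1 * t powr \<rho> / 1) at_top"
      by (intro tendsto_intros filterlim_compose[OF ratio fl] ratio varies_with_indexD[OF vr t]) auto
    moreover have "\<forall>\<^sub>F x in at_top. (f (t * x) / g (t * x)) * (g (t * x) / g x) / (f x / g x) = f (t * x) / f x"
      using gpos eventually_compose_filterlim[OF gpos fl] by eventually_elim simp
    ultimately show "((\<lambda>x. f (t * x) / f x) \<longlongrightarrow> t powr \<rho>) at_top"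
      by (simp add: Lim_transform_eventually)
  qed
qed

definition cumulative :: "(real \<Rightarrow> real) \<Rightarrow> real \<Rightarrow> real" where
  "cumulative g x = (\<integral>s. indicator {0..x} s * g s \<partial>lborel)"

lemma cumulative_integrable:
  assumes "mono (g :: real \<Rightarrow> real)"
  shows "integrable lborel (\<lambda>s. indicator {a..b} s * g s)"
proof -
  have [measurable]: "g \<in> borel_measurable borel" using assms by (rule borel_measurable_mono)
  show ?thesis
  proof (rule integrableI_bounded_set_indicator[of "{a..b}" lborel g "max \<bar>g a\<bar> \<bar>g b\<bar>", unfolded real_scaleR_def])
    show "AE x in lborel. x \<in> {a..b} \<longrightarrow> norm (g x) \<le> max \<bar>g a\<bar> \<bar>g b\<bar>"
    proof (rule AE_I2, rule impI)
      fix x assume "x \<in> {a..b}"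
      then have "g a \<le> g x" "g x \<le> g b" using assms by (auto dest: monoD)
      then show "norm (g x) \<le> max \<bar>g a\<bar> \<bar>g b\<bar>" by auto
    qed
  qed (auto simp: emeasure_lborel_Icc_eq)
qed

lemma cumulative_increment:
  assumes "mono (g :: real \<Rightarrow> real)" "0 \<le> a" "a \<le> b"
  shows "g a * (b - a) \<le> cumulative g b - cumulative g a"
    and "cumulative g b - cumulative g a \<le> g b * (b - a)"
proof -
  have ae: "AE s in lborel. s \<noteq> a" by (rule AE_lborel_singleton)
  have [measurable]: "g \<in> borel_measurable borel" using assms(1) by (rule borel_measurable_mono)
  have "cumulative g b - cumulative g a = (\<integral>s. indicator {0..b} s * g s - indicator {0..a} s * g s \<partial>lborel)"
    unfolding cumulative_def using cumulative_integrable[OF assms(1)]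
    by (intro Bochner_Integration.integral_diff[symmetric]) auto
  also have "\<dots> = (\<integral>s. indicator {a..b} s * g s \<partial>lborel)"
  proof (rule integral_cong_AE)
    show "AE s in lborel. indicator {0..b} s * g s - indicator {0..a} s * g s = indicator {a..b} s * g s"
      using ae by eventually_elim (use assms in \<open>auto simp: indicator_def\<close>)
  qed auto
  finally have e: "cumulative g b - cumulative g a = (\<integral>s. indicator {a..b} s * g s \<partial>lborel)" .
  have c: "(\<integral>s. indicator {a..b} s * K \<partial>lborel) = K * (b - a)" for K :: real
    using assms by simp
  have ci: "integrable lborel (\<lambda>s. indicator {a..b} s * K)" for K :: real
    using assms by auto
  show "g a * (b - a) \<le> cumulative g b - cumulative g a"
    unfolding e c[symmetric] using assms(1)
    by (intro integral_mono ci cumulative_integrable) (auto simp: indicator_def dest: monoD)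
  show "cumulative g b - cumulative g a \<le> g b * (b - a)"
    unfolding e c[symmetric] using assms(1)
    by (intro integral_mono ci cumulative_integrable) (auto simp: indicator_def dest: monoD)
qed

text \<open>Rescaling gives \<open>cumulative g x / (x * g x) = \<integral> g (x * s) / g x ds\<close> over the unit interval. The integrand
  tends to \<open>s powr \<rho>\<close> and, by monotonicity, stays below 1, so dominated convergence applies.\<close>

lemma Karamata_monotone:
  assumes vr: "varies_with_index \<rho> g" and nn: "\<And>x. g x \<ge> 0" and mono: "mono g" and "\<rho> > 0"
  shows "((\<lambda>x. cumulative g x / (x * g x)) \<longlongrightarrow> 1 / (\<rho> + 1)) at_top"
proof -
  have [measurable]: "g \<in> borel_measurable borel" using mono by (rule borel_measurable_mono)
  have lim: "((\<lambda>x. \<integral>s. indicator {0<..1} s * (g (x * s) / g x) \<partial>lborel) \<longlongrightarrow>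
        (\<integral>s. indicator {0<..1} s * s powr \<rho> \<partial>lborel)) at_top"
  proof (rule integral_dominated_convergence_at_top[where w = "indicator {0<..1}"])
    show "AE s in lborel. ((\<lambda>x. indicator {0<..1} s * (g (x * s) / g x)) \<longlongrightarrow> indicator {0<..1} s * s powr \<rho>) at_top"
    proof (rule AE_I2)
      fix s :: real
      show "((\<lambda>x. indicator {0<..1} s * (g (x * s) / g x)) \<longlongrightarrow> indicator {0<..1} s * s powr \<rho>) at_top"
        using varies_with_indexD[OF vr, of s] by (cases "s \<in> {0<..1}") (auto simp: mult.commute)
    qed
    show "\<forall>\<^sub>F x in at_top. AE s in lborel. norm (indicator {0<..1} s * (g (x * s) / g x)) \<le> indicator {0<..1} s"
      using eventually_gt_at_top[of 0] index_eventually_pos[OF vr nn]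
    proof eventually_elim
      case (elim x)
      show ?case
      proof (rule AE_I2)
        fix s :: real
        have "g (x * s) \<le> g x" if "s \<le> 1" using elim that by (intro monoD[OF mono]) (simp add: mult_left_le)
        then show "norm (indicator {0<..1} s * (g (x * s) / g x)) \<le> indicator {0<..1} s"
          using elim nn[of "x * s"] by (auto simp: indicator_def)
      qed
    qed
  qed auto
  have val: "(\<integral>s. indicator {0<..1} s * s powr \<rho> \<partial>lborel) = 1 / (\<rho> + 1)"
  proof -
    have si: "set_integrable lborel {0..1} (\<lambda>s::real. s powr \<rho>)"
      using \<open>\<rho> > 0\<close> by (intro borel_integrable_atLeastAtMost' continuous_on_powr') (auto intro: continuous_intros)
    have "((\<lambda>s. s powr \<rho>) has_integral (1 powr (\<rho>+1) / (\<rho>+1))) {0..1}"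
      using \<open>\<rho> > 0\<close> by (intro has_integral_powr_from_0) auto
    then have "(\<integral>s. s powr \<rho> * indicator {0..1} s \<partial>lborel) = 1 / (\<rho> + 1)"
      using set_borel_integral_eq_integral(2)[OF si]
      by (simp add: integral_unique set_lebesgue_integral_def mult.commute)
    moreover have "(\<integral>s. indicator {0<..1} s * s powr \<rho> \<partial>lborel) = (\<integral>s. s powr \<rho> * indicator {0..1} s \<partial>lborel)"
      by (rule Bochner_Integration.integral_cong) (auto simp: indicator_def)
    ultimately show ?thesis by simp
  qed
  have "\<forall>\<^sub>F x in at_top. (\<integral>s. indicator {0<..1} s * (g (x * s) / g x) \<partial>lborel) = cumulative g x / (x * g x)"
    using eventually_gt_at_top[of 0] index_eventually_pos[OF vr nn]
  proof eventually_elim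
    case (elim x)
    have "cumulative g x = \<bar>x\<bar> *\<^sub>R (\<integral>s. indicator {0..x} (0 + x * s) * g (0 + x * s) \<partial>lborel)"
      unfolding cumulative_def using elim by (intro lborel_integral_real_affine) auto
    also have "(\<integral>s. indicator {0..x} (0 + x * s) * g (0 + x * s) \<partial>lborel) = (\<integral>s. indicator {0<..1} s * g (x * s) \<partial>lborel)"
    proof (rule integral_cong_AE)
      show "AE s in lborel. indicator {0..x} (0 + x * s) * g (0 + x * s) = indicator {0<..1} s * g (x * s)"
        using AE_lborel_singleton[of 0]
        by eventually_elim (use elim in \<open>auto simp: indicator_def zero_le_mult_iff mult_le_cancel_left1\<close>)
    qed auto
    finally have "cumulative g x = x * (\<integral>s. indicator {0<..1} s * g (x * s) \<partial>lborel)" using elim by simp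
    moreover have "(\<integral>s. indicator {0<..1} s * (g (x * s) / g x) \<partial>lborel) = (\<integral>s. indicator {0<..1} s * g (x * s) \<partial>lborel) / g x"
      by simp
    ultimately show ?case using elim by simp
  qed
  then show ?thesis using lim unfolding val by (blast intro: Lim_transform_eventually)
qed

lemma cumulative_nonpos: "x \<le> 0 \<Longrightarrow> cumulative g x = 0"
proof -
  assume x: "x \<le> 0"
  show ?thesis
    unfolding cumulative_def
  proof (rule integral_eq_zero_AE)
    show "AE s in lborel. indicator {0..x} s * g s = 0"
      using AE_lborel_singleton[of 0] by eventually_elim (use x in \<open>auto simp: indicator_def\<close>)
  qed
qed

lemma cumulative_mono:
  assumes "mono (g :: real \<Rightarrow> real)" "\<And>s. 0 \<le> g s"
  shows "mono (cumulative g)"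
  unfolding mono_def cumulative_def using assms
  by (intro allI impI integral_mono cumulative_integrable) (auto simp: indicator_def)

section \<open>Tangents from a point of the axis\<close>

text \<open>The smallest slope of a line through \<open>(y, 0)\<close> and a point of the graph of \<open>h\<close> to the right of \<open>y\<close>; for a
  convex \<open>h\<close> it is the slope of the tangent through \<open>(y, 0)\<close>. It will be the least price per unit of growth
  of a perpetuity that is at level \<open>y\<close>.\<close>

definition tangent_slope :: "(real \<Rightarrow> real) \<Rightarrow> real \<Rightarrow> real" where
  "tangent_slope h y = (INF x\<in>{y<..}. h x / (x - y))"

lemma tangent_slope_le:
  assumes "\<And>x. 0 \<le> h x" "y < x"
  shows "tangent_slope h y \<le> h x / (x - y)"
proof -
  have "bdd_below ((\<lambda>x. h x / (x - y)) ` {y<..})"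
    by (rule bdd_belowI[of _ 0]) (use assms in auto)
  then show ?thesis unfolding tangent_slope_def using assms(2) by (intro cINF_lower) auto
qed

lemma tangent_slope_greatest:
  assumes "\<And>x. y < x \<Longrightarrow> c \<le> h x / (x - y)"
  shows "c \<le> tangent_slope h y"
  unfolding tangent_slope_def by (rule cINF_greatest) (use assms in auto)

lemma tangent_slope_nonneg: "(\<And>x. 0 \<le> h x) \<Longrightarrow> 0 \<le> tangent_slope h y"
  by (rule tangent_slope_greatest) auto

lemma tangent_slope_mono:
  assumes "\<And>x. 0 \<le> h x"
  shows "mono (tangent_slope h)"
proof (rule monoI)
  fix y y' :: real assume "y \<le> y'"
  show "tangent_slope h y \<le> tangent_slope h y'"
  proof (rule tangent_slope_greatest)
    fix x assume "y' < x"
    then have "tangent_slope h y \<le> h x / (x - y)" using \<open>y \<le> y'\<close> assms by (intro tangent_slope_le) auto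
    also have "\<dots> \<le> h x / (x - y')"
      using \<open>y \<le> y'\<close> \<open>y' < x\<close> assms by (intro divide_left_mono) auto
    finally show "tangent_slope h y \<le> h x / (x - y')" .
  qed
qed

text \<open>The right-hand side is convex, and the left-hand side is its tangent at \<open>g / (g - 1)\<close>, which is the tangent
  that passes through \<open>(1, 0)\<close>.\<close>

lemma powr_above_chord_slope:
  fixes u g :: real
  assumes "g > 1" "u > 0"
  shows "g * (g / (g - 1)) powr (g - 1) * (u - 1) \<le> u powr g"
proof -
  define w where "w = g / (g - 1)"
  have w: "w > 0" "w * (g - 1) = g" using assms by (auto simp: w_def)
  have tangent: "u powr g - w powr g \<ge> (g * w powr (g - 1)) * (u - w)"
  proof (rule convex_on_imp_above_tangent[where A = "{0<..}"])
    show "convex_on {0<..} (\<lambda>u. u powr g)" using assms by (intro powr_convex) auto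
    show "((\<lambda>u. u powr g) has_real_derivative g * w powr (g - 1)) (at w within {0<..})"
      using w by (auto intro!: derivative_eq_intros)
  qed (use w assms in \<open>auto simp: interior_open\<close>)
  have e: "w powr g = w * w powr (g - 1)" using w by (simp add: powr_mult_base)
  have "g * w powr (g - 1) * (u - 1) = g * w powr (g - 1) * (u - w) + w powr (g - 1) * (g * (w - 1))"
    by (simp add: algebra_simps)
  also have "g * (w - 1) = w" using w by (simp add: algebra_simps)
  finally show ?thesis using tangent e unfolding w_def[symmetric] by (simp add: mult.commute)
qed

lemma touching_point_value:
  fixes g :: real
  assumes "g > 1"
  shows "(g / (g - 1)) powr g = g * (g / (g - 1)) powr (g - 1) * (g / (g - 1) - 1)"
proof -
  define w where "w = g / (g - 1)"
  have w: "w > 1" "w * (g - 1) = g" using assms by (auto simp: w_def)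
  have "w powr g = w * w powr (g - 1)" using w by (simp add: powr_mult_base)
  moreover have "g * (w - 1) = w" using w by (simp add: algebra_simps)
  ultimately show ?thesis unfolding w_def[symmetric] by (metis mult.assoc mult.commute)
qed

text \<open>With \<open>x = u * y\<close> the chord slope is asymptotically \<open>u powr \<gamma> / (u - 1) * h y / y\<close>, and the constant is the minimum
  over \<open>u > 1\<close>, attained at \<open>u = \<gamma> / (\<gamma> - 1)\<close>. That value of \<open>u\<close> gives the upper estimate. The lower one must hold
  for all \<open>u\<close> at once; the Potter bound gives it with an exponent slightly below \<open>\<gamma>\<close>.\<close>

lemma tangent_slope_asymp:
  fixes h :: "real \<Rightarrow> real"
  assumes vr: "varies_with_index \<gamma> h" and nn: "\<And>x. 0 \<le> h x" and mono: "mono h" and \<gamma>: "\<gamma> > 1"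
  shows "((\<lambda>y. tangent_slope h y * y / h y) \<longlongrightarrow> \<gamma> * (\<gamma> / (\<gamma> - 1)) powr (\<gamma> - 1)) at_top"
proof (rule order_tendstoI)
  define w where "w = \<gamma> / (\<gamma> - 1)"
  have w: "w > 1" "w * (\<gamma> - 1) = \<gamma>" using \<gamma> by (auto simp: w_def)
  fix B assume B: "\<gamma> * (\<gamma> / (\<gamma> - 1)) powr (\<gamma> - 1) < B"
  have "w powr \<gamma> = \<gamma> * w powr (\<gamma> - 1) * (w - 1)"
    unfolding w_def using \<gamma> by (rule touching_point_value)
  also have "\<dots> < B * (w - 1)"
    using B w unfolding w_def[symmetric] by (intro mult_strict_right_mono) auto
  finally have "((\<lambda>y. h (w * y) / h y) \<longlongrightarrow> w powr \<gamma>) at_top \<and> w powr \<gamma> < B * (w - 1)"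
    using varies_with_indexD[OF vr] w by auto
  then have "\<forall>\<^sub>F y in at_top. h (w * y) / h y < B * (w - 1)"
    using order_tendstoD(2) by blast
  then show "\<forall>\<^sub>F y in at_top. tangent_slope h y * y / h y < B"
    using eventually_gt_at_top[of 0] index_eventually_pos[OF vr nn]
  proof eventually_elim
    case (elim y)
    have "tangent_slope h y \<le> h (w * y) / (w * y - y)"
      using elim w nn by (intro tangent_slope_le) auto
    also have "w * y - y = (w - 1) * y" by (simp add: algebra_simps)
    finally have "tangent_slope h y * y \<le> h (w * y) / (w - 1)"
      using elim w by (simp add: field_simps)
    also have "\<dots> < B * h y" using elim w by (simp add: field_simps)
    finally show ?case using elim by (simp add: field_simps)
  qed
next
  fix B assume B: "B < \<gamma> * (\<gamma> / (\<gamma> - 1)) powr (\<gamma> - 1)"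
  have "((\<lambda>e. (1 - e) * ((\<gamma> - e) * ((\<gamma> - e) / ((\<gamma> - e) - 1)) powr ((\<gamma> - e) - 1)))
       \<longlongrightarrow> (1 - 0) * ((\<gamma> - 0) * ((\<gamma> - 0) / ((\<gamma> - 0) - 1)) powr ((\<gamma> - 0) - 1))) (at_right 0)"
    using \<gamma> by (intro tendsto_intros) auto
  then have "\<forall>\<^sub>F e in at_right 0. B < (1 - e) * ((\<gamma> - e) * ((\<gamma> - e) / ((\<gamma> - e) - 1)) powr ((\<gamma> - e) - 1))"
    using B by (intro order_tendstoD) auto
  moreover have "\<forall>\<^sub>F e in at_right 0. 0 < e \<and> e < min 1 (\<gamma> - 1)"
    using \<gamma> by (auto simp: eventually_at_right_less eventually_conj_iff intro!: eventually_at_right_real order_tendstoD)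
  ultimately have "\<forall>\<^sub>F e in at_right 0. B < (1 - e) * ((\<gamma> - e) * ((\<gamma> - e) / ((\<gamma> - e) - 1)) powr ((\<gamma> - e) - 1)) \<and> 0 < e \<and> e < min 1 (\<gamma> - 1)"
    by eventually_elim auto
  then obtain e where e: "B < (1 - e) * ((\<gamma> - e) * ((\<gamma> - e) / ((\<gamma> - e) - 1)) powr ((\<gamma> - e) - 1))"
    "0 < e" "e < 1" "e < \<gamma> - 1"
    using eventually_happens'[OF trivial_limit_at_right_real] by fastforce
  define g where "g = \<gamma> - e"
  define K where "K = g * (g / (g - 1)) powr (g - 1)"
  have g: "g > 1" "g < \<gamma>" "B < (1 - e) * K" using e by (auto simp: g_def K_def)
  obtain Y where Y: "Y > 0" "\<And>x y. Y \<le> y \<Longrightarrow> y \<le> x \<Longrightarrow> (1 - e) * (x / y) powr g * h y \<le> h x"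
    using g e by (auto intro: Potter_lower[OF vr nn mono, of g "1 - e"])
  show "\<forall>\<^sub>F y in at_top. B < tangent_slope h y * y / h y"
    using eventually_ge_at_top[of Y] index_eventually_pos[OF vr nn]
  proof eventually_elim
    case (elim y)
    have y: "y > 0" using elim Y by simp
    have "(1 - e) * K * h y / y \<le> tangent_slope h y"
    proof (rule tangent_slope_greatest)
      fix x assume x: "y < x"
      have "K * (x / y - 1) \<le> (x / y) powr g"
        unfolding K_def using g x y by (intro powr_above_chord_slope) auto
      then have "(1 - e) * h y * (K * (x / y - 1)) \<le> (1 - e) * h y * (x / y) powr g"
        using e elim by (intro mult_left_mono) auto
      also have "\<dots> \<le> h x" using Y(2)[of y x] elim x by (simp add: mult_ac)
      finally have "((1 - e) * K * h y / y) * (x - y) \<le> h x"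
        using y by (simp add: field_simps)
      then show "(1 - e) * K * h y / y \<le> h x / (x - y)" using x by (simp add: pos_le_divide_eq)
    qed
    moreover have "B * h y / y < (1 - e) * K * h y / y"
      using g elim y by (intro divide_strict_right_mono mult_strict_right_mono) auto
    ultimately have "B * h y / y < tangent_slope h y" by simp
    then show ?case using y elim by (simp add: field_simps)
  qed
qed

section \<open>The cost of a level\<close>

text \<open>If \<open>exp (- m t)\<close> is the probability of \<open>1 / (1 - M) > t\<close> and \<open>exp (- k q)\<close> that of \<open>Q > q\<close>, then bringing a perpetuity to
  a level of order \<open>x\<close> by holding \<open>M\<close> near \<open>1 - 1 / t\<close> and \<open>Q\<close> near \<open>x / t\<close> for about \<open>t\<close> steps costs \<open>t * (m t + k (x / t))\<close>.
  For the tail costs of \<open>1 / (1 - M)\<close> and \<open>Q\<close> the infimum is \<open>h_ind\<close>.\<close>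

definition perp_cost :: "(real \<Rightarrow> real) \<Rightarrow> (real \<Rightarrow> real) \<Rightarrow> real \<Rightarrow> real" where
  "perp_cost m k x = (INF t\<in>{1..}. t * (m t + k (x / t)))"

lemma perp_cost_le:
  assumes "\<And>t. 0 \<le> m t" "\<And>q. 0 \<le> k q" "1 \<le> t"
  shows "perp_cost m k x \<le> t * (m t + k (x / t))"
proof -
  have "bdd_below ((\<lambda>t. t * (m t + k (x / t))) ` {1..})"
    by (rule bdd_belowI[of _ 0]) (use assms in \<open>auto intro!: mult_nonneg_nonneg add_nonneg_nonneg\<close>)
  then show ?thesis unfolding perp_cost_def using assms(3) by (intro cINF_lower) auto
qed

lemma perp_cost_greatest:
  assumes "\<And>t. 1 \<le> t \<Longrightarrow> c \<le> t * (m t + k (x / t))"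
  shows "c \<le> perp_cost m k x"
  unfolding perp_cost_def by (rule cINF_greatest) (use assms in auto)

lemma perp_cost_nonneg:
  assumes "\<And>t. 0 \<le> m t" "\<And>q. 0 \<le> k q"
  shows "0 \<le> perp_cost m k x"
  by (rule perp_cost_greatest) (use assms in \<open>auto intro!: mult_nonneg_nonneg add_nonneg_nonneg\<close>)

locale regular_costs =
  fixes m k :: "real \<Rightarrow> real" and \<alpha> r :: real
  assumes m_mono: "mono m" and k_mono: "mono k"
    and m_nonneg: "\<And>t. 0 \<le> m t" and k_nonneg: "\<And>q. 0 \<le> k q"
    and m_index: "varies_with_index (r - 1) m" and k_index: "varies_with_index \<alpha> k"
    and r_gt_1: "r > 1" and \<alpha>_gt_1: "\<alpha> > 1"
begin

abbreviation "h \<equiv> perp_cost m k"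

definition "\<gamma> = \<alpha> * r / (\<alpha> + r - 1)"

lemma \<gamma>_gt_1: "\<gamma> > 1"
proof -
  have "0 < (\<alpha> - 1) * (r - 1)" using \<alpha>_gt_1 r_gt_1 by simp
  then have "\<alpha> + r - 1 < \<alpha> * r" by (simp add: algebra_simps)
  then show ?thesis using \<alpha>_gt_1 r_gt_1 by (simp add: \<gamma>_def)
qed

lemma m_at_top: "filterlim m at_top at_top"
  using index_at_top[OF m_index m_nonneg m_mono] r_gt_1 by simp

lemma k_at_top: "filterlim k at_top at_top"
  using index_at_top[OF k_index k_nonneg k_mono] \<alpha>_gt_1 by simp

lemma h_le: "1 \<le> t \<Longrightarrow> h x \<le> t * (m t + k (x / t))"
  by (rule perp_cost_le[OF m_nonneg k_nonneg])

lemma h_nonneg: "0 \<le> h x"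
  by (rule perp_cost_nonneg[OF m_nonneg k_nonneg])

lemma h_mono: "mono h"
proof (rule monoI, rule perp_cost_greatest)
  fix x y t :: real assume "x \<le> y" "1 \<le> t"
  then have "t * (m t + k (x / t)) \<le> t * (m t + k (y / t))"
    by (intro mult_left_mono add_left_mono monoD[OF k_mono] divide_right_mono) auto
  then show "h x \<le> t * (m t + k (y / t))" using h_le[OF \<open>1 \<le> t\<close>, of x] by simp
qed

lemma h_at_top: "filterlim h at_top at_top"
  unfolding filterlim_at_top
proof
  fix Z :: real
  have s: "filterlim sqrt at_top at_top" by (rule sqrt_at_top)
  have "\<forall>\<^sub>F x in at_top. Z \<le> m (sqrt x)"
    using filterlim_compose[OF m_at_top s] by (simp add: filterlim_at_top)
  moreover have "\<forall>\<^sub>F x in at_top. Z \<le> k (sqrt x)"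
    using filterlim_compose[OF k_at_top s] by (simp add: filterlim_at_top)
  ultimately show "\<forall>\<^sub>F x in at_top. Z \<le> h x"
    using eventually_gt_at_top[of 0]
  proof eventually_elim
    case (elim x)
    show ?case
    proof (rule perp_cost_greatest)
      fix t :: real assume t: "1 \<le> t"
      have "Z \<le> m t + k (x / t)"
      proof (cases "sqrt x \<le> t")
        case True
        then show ?thesis using elim monoD[OF m_mono True] k_nonneg[of "x / t"] by linarith
      next
        case False
        then have "sqrt x \<le> x / t"
          using t elim by (simp add: pos_le_divide_eq) (metis less_eq_real_def mult.commute mult_left_mono not_le real_sqrt_ge_zero real_sqrt_mult_self abs_of_pos)
        then show ?thesis using elim monoD[OF k_mono] m_nonneg[of t] by (smt (verit))
      qed
      also have "\<dots> \<le> t * (m t + k (x / t))"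
        using mult_right_mono[OF t, of "m t + k (x / t)"] m_nonneg[of t] k_nonneg[of "x / t"] by simp
      finally show "Z \<le> t * (m t + k (x / t))" .
    qed
  qed
qed

text \<open>Every fixed \<open>t\<close> competes in the infimum and yields \<open>h (C * x) / k x\<close> of order \<open>t powr (1 - \<alpha>)\<close>, which is
  small for large \<open>t\<close>. In the next lemma \<open>x / t\<close> is fixed instead.\<close>

lemma h_le_small_k:
  assumes "C > 0" "e > 0"
  shows "\<forall>\<^sub>F x in at_top. h (C * x) \<le> e * k x"
proof -
  have "((\<lambda>t::real. 2 * t * (C / t) powr \<alpha>) \<longlongrightarrow> 0) at_top"
    using assms \<alpha>_gt_1 by real_asymp
  then have "\<forall>\<^sub>F t::real in at_top. 2 * t * (C / t) powr \<alpha> < e / 2"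
    using assms by (intro order_tendstoD) auto
  then have "\<forall>\<^sub>F t::real in at_top. 2 * t * (C / t) powr \<alpha> < e / 2 \<and> t \<ge> 1"
    using eventually_ge_at_top[of 1] by eventually_elim auto
  then obtain t :: real where t: "2 * t * (C / t) powr \<alpha> < e / 2" "t \<ge> 1"
    using eventually_happens'[OF trivial_limit_at_top_linorder] by blast
  have "\<forall>\<^sub>F x in at_top. k (C / t * x) \<le> (2 * (C / t) powr \<alpha>) * k x"
    using assms t by (intro index_eventually_le[OF k_index k_nonneg]) auto
  moreover have "\<forall>\<^sub>F x in at_top. t * m t / (e / 2) \<le> k x"
    using k_at_top by (simp add: filterlim_at_top)
  ultimately show ?thesis
  proof eventually_elim
    case (elim x)
    have "h (C * x) \<le> t * (m t + k (C * x / t))" by (rule h_le[OF t(2)])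
    also have "C * x / t = C / t * x" by simp
    also have "t * (m t + k (C / t * x)) \<le> t * m t + t * (2 * (C / t) powr \<alpha> * k x)"
      using elim t by (simp add: distrib_left mult_left_mono)
    also have "t * m t \<le> e / 2 * k x" using elim assms by (simp add: field_simps)
    also have "t * (2 * (C / t) powr \<alpha> * k x) \<le> e / 2 * k x"
      using mult_right_mono[OF less_imp_le[OF t(1)] k_nonneg[of x]] by (simp add: mult_ac)
    finally show ?case by simp
  qed
qed

lemma h_le_small_m:
  assumes "C > 0" "e > 0"
  shows "\<forall>\<^sub>F x in at_top. h (C * x) \<le> e * (x * m x)"
proof -
  have "((\<lambda>q::real. 3 * ((C / q) * (C / q) powr (r - 1))) \<longlongrightarrow> 0) at_top"
    using assms r_gt_1 by real_asymp
  then have "\<forall>\<^sub>F q::real in at_top. 3 * ((C / q) * (C / q) powr (r - 1)) < e"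
    using assms by (intro order_tendstoD) auto
  then have "\<forall>\<^sub>F q::real in at_top. 3 * ((C / q) * (C / q) powr (r - 1)) < e \<and> q > 0"
    using eventually_gt_at_top[of 0] by eventually_elim auto
  then obtain q :: real where q: "3 * ((C / q) * (C / q) powr (r - 1)) < e" "q > 0"
    using eventually_happens'[OF trivial_limit_at_top_linorder] by blast
  define d where "d = (C / q) powr (r - 1)"
  have d: "d > 0" using q assms by (simp add: d_def)
  have "\<forall>\<^sub>F x in at_top. m (C / q * x) \<le> (2 * d) * m x"
    using assms q by (intro index_eventually_le[OF m_index m_nonneg]) (auto simp: d_def)
  moreover have "\<forall>\<^sub>F x in at_top. k q / d \<le> m x"
    using m_at_top by (simp add: filterlim_at_top)
  moreover have "\<forall>\<^sub>F x in at_top. x \<ge> q / C" by (rule eventually_ge_at_top)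
  ultimately show ?thesis
  proof eventually_elim
    case (elim x)
    have t: "C / q * x \<ge> 1" and x: "x > 0" using elim assms q by (auto simp: field_simps intro: less_le_trans[of 0 "q / C"])
    have "h (C * x) \<le> (C / q * x) * (m (C / q * x) + k (C * x / (C / q * x)))" by (rule h_le[OF t])
    also have "C * x / (C / q * x) = q" using assms q x by simp
    also have "(C / q * x) * (m (C / q * x) + k q) \<le> (C / q * x) * (2 * d * m x + d * m x)"
      using elim t d by (intro mult_left_mono add_mono) (auto simp: field_simps)
    also have "\<dots> = 3 * ((C / q) * d) * (x * m x)" by (simp add: field_simps)
    also have "\<dots> \<le> e * (x * m x)"
      using q x m_nonneg[of x] by (intro mult_right_mono) (auto simp: d_def)
    finally show ?case .
  qed
qed

text \<open>Near-minimizers \<open>t\<close> tend to infinity, and so does \<open>x / t\<close>: a bounded \<open>t\<close> would cost a multiple of \<open>k x\<close>, a bounded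
  \<open>x / t\<close> a multiple of \<open>x * m x\<close>, and both are much larger than \<open>h x\<close>. Hence only the behaviour of \<open>m\<close> and \<open>k\<close> near infinity
  matters.\<close>

lemma near_minimizers:
  assumes "t0 \<ge> 1" "q0 > 0"
  shows "\<forall>\<^sub>F x in at_top. \<forall>t\<ge>1. t * (m t + k (x / t)) \<le> 2 * h x \<longrightarrow> t0 \<le> t \<and> q0 \<le> x / t"
proof -
  have f1: "filterlim (\<lambda>x. x / t0) at_top at_top" and f2: "filterlim (\<lambda>x. x / q0) at_top at_top"
    using assms by real_asymp+
  have "\<forall>\<^sub>F x in at_top. h (t0 * x) \<le> 1/4 * k x \<and> k x > 0"
    using assms h_le_small_k[of t0 "1/4"] index_eventually_pos[OF k_index k_nonneg]
    by (auto simp: eventually_conj_iff)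
  from eventually_compose_filterlim[OF this f1]
  have e1: "\<forall>\<^sub>F x in at_top. h x \<le> 1/4 * k (x / t0) \<and> k (x / t0) > 0"
    using assms by simp
  have "\<forall>\<^sub>F x in at_top. h (q0 * x) \<le> 1/4 * (x * m x) \<and> m x > 0"
    using assms h_le_small_m[of q0 "1/4"] index_eventually_pos[OF m_index m_nonneg]
    by (auto simp: eventually_conj_iff)
  from eventually_compose_filterlim[OF this f2]
  have e2: "\<forall>\<^sub>F x in at_top. h x \<le> 1/4 * (x / q0 * m (x / q0)) \<and> m (x / q0) > 0"
    using assms by simp
  from e1 e2 eventually_gt_at_top[of 0] show ?thesis
  proof eventually_elim
    case (elim x)
    show ?case
    proof (intro allI impI)
      fix t :: real assume t: "1 \<le> t" and le: "t * (m t + k (x / t)) \<le> 2 * h x"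
      have "t0 \<le> t"
      proof (rule ccontr)
        assume "\<not> t0 \<le> t"
        then have "x / t0 \<le> x / t" using t elim assms by (intro divide_left_mono) auto
        then have "k (x / t0) \<le> 1 * (m t + k (x / t))" using monoD[OF k_mono] m_nonneg[of t] by (simp add: add_increasing)
        also have "\<dots> \<le> t * (m t + k (x / t))"
          using t m_nonneg[of t] k_nonneg[of "x / t"] by (intro mult_right_mono) auto
        finally show False using le elim by linarith
      qed
      moreover have "q0 \<le> x / t"
      proof (rule ccontr)
        assume "\<not> q0 \<le> x / t"
        then have g: "x / q0 \<le> t" using t assms by (simp add: field_simps)
        then have "x / q0 * m (x / q0) \<le> t * (m t + k (x / t))"
          using t elim assms monoD[OF m_mono g] m_nonneg[of "x / q0"] k_nonneg[of "x / t"]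
          by (intro mult_mono) auto
        also note le
        also have "2 * h x \<le> 2 * (1/4 * (x / q0 * m (x / q0)))" using elim by (intro mult_left_mono) auto
        finally have "x / q0 * m (x / q0) \<le> 2 * (1/4 * (x / q0 * m (x / q0)))" .
        moreover have "c \<le> 0" if "c \<le> 2 * (1/4 * c)" for c :: real using that by simp
        ultimately have "x / q0 * m (x / q0) \<le> 0" by blast
        moreover have "0 < x / q0 * m (x / q0)" using elim assms by (intro mult_pos_pos) auto
        ultimately show False by simp
      qed
      ultimately show "t0 \<le> t \<and> q0 \<le> x / t" by simp
    qed
  qed
qed

text \<open>Substituting \<open>\<rho> * t\<close> for a near-minimizer \<open>t\<close> turns asymptotic inequalities between the cost functions into one
  between the infima. Applied to a pair and itself it gives the regular variation of \<open>h\<close>; applied to a pair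
  and its weighted version it gives the constant for arbitrary dependence.\<close>

lemma perp_cost_compare:
  assumes nn: "\<And>t. 0 \<le> m' t" "\<And>q. 0 \<le> k' q" and pos: "\<rho> > 0" "\<sigma> > 0" "A > 0"
    and cm: "\<forall>\<^sub>F t in at_top. \<rho> * m' (\<rho> * t) \<le> A * m t"
    and ck: "\<forall>\<^sub>F q in at_top. \<rho> * k' (\<sigma> * q) \<le> A * k q"
  shows "\<forall>\<^sub>F x in at_top. perp_cost m' k' (\<rho> * \<sigma> * x) \<le> A * h x"
proof -
  obtain t0 where t0: "\<And>t. t \<ge> t0 \<Longrightarrow> \<rho> * m' (\<rho> * t) \<le> A * m t"
    using cm by (auto simp: eventually_at_top_linorder)
  obtain q0 where q0: "\<And>q. q \<ge> q0 \<Longrightarrow> \<rho> * k' (\<sigma> * q) \<le> A * k q"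
    using ck by (auto simp: eventually_at_top_linorder)
  have "\<forall>\<^sub>F x in at_top. h x > 0" using h_at_top by (simp add: filterlim_at_top_dense)
  moreover have "\<forall>\<^sub>F x in at_top. \<forall>t\<ge>1. t * (m t + k (x / t)) \<le> 2 * h x \<longrightarrow>
      max 1 (max t0 (1 / \<rho>)) \<le> t \<and> max 1 q0 \<le> x / t"
    by (rule near_minimizers) auto
  ultimately show ?thesis
  proof eventually_elim
    case (elim x)
    have "min (2 * h x) (perp_cost m' k' (\<rho> * \<sigma> * x) / A) \<le> h x"
    proof (rule perp_cost_greatest)
      fix t :: real assume t: "1 \<le> t"
      show "min (2 * h x) (perp_cost m' k' (\<rho> * \<sigma> * x) / A) \<le> t * (m t + k (x / t))"
      proof (cases "t * (m t + k (x / t)) \<le> 2 * h x")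
        case True
        then have tt: "t0 \<le> t" "1 / \<rho> \<le> t" "q0 \<le> x / t" using elim t by auto
        have "perp_cost m' k' (\<rho> * \<sigma> * x) \<le> (\<rho> * t) * (m' (\<rho> * t) + k' (\<rho> * \<sigma> * x / (\<rho> * t)))"
          using tt pos by (intro perp_cost_le nn) (simp add: field_simps)
        also have "\<rho> * \<sigma> * x / (\<rho> * t) = \<sigma> * (x / t)" using pos by simp
        also have "(\<rho> * t) * (m' (\<rho> * t) + k' (\<sigma> * (x / t))) = t * (\<rho> * m' (\<rho> * t) + \<rho> * k' (\<sigma> * (x / t)))"
          by (simp add: algebra_simps)
        also have "\<dots> \<le> t * (A * m t + A * k (x / t))"
          using t0[OF tt(1)] q0[OF tt(3)] t by (intro mult_left_mono add_mono) auto
        also have "\<dots> = A * (t * (m t + k (x / t)))" by (simp add: algebra_simps)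
        finally show ?thesis using pos by (simp add: min.coboundedI2 field_simps)
      qed auto
    qed
    then have "perp_cost m' k' (\<rho> * \<sigma> * x) / A \<le> h x" using elim by linarith
    then show ?case using pos by (simp add: field_simps)
  qed
qed

lemma h_scale:
  assumes "\<theta> > 0" "\<theta> powr \<gamma> < A"
  shows "\<forall>\<^sub>F x in at_top. h (\<theta> * x) \<le> A * h x"
proof -
  (* The split of theta into rho * sigma for which both cost terms scale by the same factor. *)
  define \<rho> where "\<rho> = \<theta> powr (\<alpha> / (\<alpha> + r - 1))"
  define \<sigma> where "\<sigma> = \<theta> powr ((r - 1) / (\<alpha> + r - 1))"
  have s: "\<alpha> + r - 1 > 0" using \<alpha>_gt_1 r_gt_1 by simp
  have pos: "\<rho> > 0" "\<sigma> > 0" "A > 0" using assms(1) le_less_trans[OF powr_ge_zero assms(2)]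
    by (auto simp: \<rho>_def \<sigma>_def)
  have prod: "\<rho> * \<sigma> = \<theta>"
    using assms s by (simp add: \<rho>_def \<sigma>_def powr_add[symmetric] add_divide_distrib[symmetric] add_diff_eq)
  have x1: "\<alpha> / (\<alpha> + r - 1) + \<alpha> / (\<alpha> + r - 1) * (r - 1) = \<gamma>"
    and x2: "\<alpha> / (\<alpha> + r - 1) + (r - 1) / (\<alpha> + r - 1) * \<alpha> = \<gamma>"
    unfolding \<gamma>_def times_divide_eq_left add_divide_distrib[symmetric] by (simp_all add: algebra_simps)
  have e1: "\<rho> * \<rho> powr (r - 1) = \<theta> powr \<gamma>"
    unfolding \<rho>_def powr_powr powr_add[symmetric] x1 ..
  have e2: "\<rho> * \<sigma> powr \<alpha> = \<theta> powr \<gamma>"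
    unfolding \<rho>_def \<sigma>_def powr_powr powr_add[symmetric] x2 ..
  have "\<forall>\<^sub>F x in at_top. h (\<rho> * \<sigma> * x) \<le> A * h x"
  proof (rule perp_cost_compare[OF m_nonneg k_nonneg pos])
    have "\<rho> powr (r - 1) < A / \<rho>" using e1 assms pos by (simp add: field_simps)
    from index_eventually_le[OF m_index m_nonneg pos(1) this]
    show "\<forall>\<^sub>F t in at_top. \<rho> * m (\<rho> * t) \<le> A * m t" using pos by (simp add: field_simps)
    have "\<sigma> powr \<alpha> < A / \<rho>" using e2 assms pos by (simp add: field_simps)
    from index_eventually_le[OF k_index k_nonneg pos(2) this]
    show "\<forall>\<^sub>F t in at_top. \<rho> * k (\<sigma> * t) \<le> A * k t" using pos by (simp add: field_simps)
  qed
  then show ?thesis by (simp add: prod)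
qed

lemma h_index: "varies_with_index \<gamma> h"
  unfolding varies_with_index_def
proof (intro allI impI order_tendstoI)
  fix \<theta> :: real assume l: "\<theta> > 0"
  have hpos: "\<forall>\<^sub>F x in at_top. h x > 0" using h_at_top by (simp add: filterlim_at_top_dense)
  fix A assume A: "\<theta> powr \<gamma> < A"
  then obtain A' where A': "\<theta> powr \<gamma> < A'" "A' < A" using dense by blast
  from h_scale[OF l A'(1)] hpos show "\<forall>\<^sub>F x in at_top. h (\<theta> * x) / h x < A"
  proof eventually_elim
    case (elim x)
    have "h (\<theta> * x) / h x \<le> A'" using elim by (simp add: field_simps)
    then show ?case using A' by simp
  qed
next
  fix \<theta> :: real assume l: "\<theta> > 0"
  have hpos: "\<forall>\<^sub>F x in at_top. h x > 0" using h_at_top by (simp add: filterlim_at_top_dense)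
  fix A assume A: "A < \<theta> powr \<gamma>"
  have fl: "filterlim (\<lambda>x. \<theta> * x) at_top at_top" using l by real_asymp
  have lp: "\<theta> powr \<gamma> > 0" using l by simp
  define B where "B = max A (\<theta> powr \<gamma> / 2)"
  have "B < \<theta> powr \<gamma>" "B > 0" "A \<le> B" using A lp by (auto simp: B_def less_max_iff_disj)
  then obtain B' where B': "B < B'" "B' < \<theta> powr \<gamma>" "B' > 0" "A < B'" using dense[of B "\<theta> powr \<gamma>"] by (metis le_less_trans less_trans)
  have "(1 / \<theta>) powr \<gamma> < 1 / B'" using B' l by (simp add: powr_divide field_simps)
  from h_scale[OF _ this] l have "\<forall>\<^sub>F x in at_top. h (1 / \<theta> * x) \<le> 1 / B' * h x" by simp
  from eventually_compose_filterlim[OF this fl]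
  have "\<forall>\<^sub>F x in at_top. h x \<le> 1 / B' * h (\<theta> * x)" using l by simp
  then show "\<forall>\<^sub>F x in at_top. A < h (\<theta> * x) / h x" using hpos
  proof eventually_elim
    case (elim x)
    have "B' \<le> h (\<theta> * x) / h x" using elim B' by (simp add: field_simps)
    then show ?case using B' by simp
  qed
qed

end

section \<open>The value function and its exponential drift\<close>

context regular_costs
begin

text \<open>The constant of the theorem. It is the constant of \<open>tangent_slope_asymp\<close> divided by \<open>\<gamma>\<close>, because integrating a
  function of index \<open>\<gamma> - 1\<close> contributes the factor \<open>1 / \<gamma>\<close>.\<close>

definition rate :: real where "rate = (\<gamma> / (\<gamma> - 1)) powr (\<gamma> - 1)"

abbreviation "p \<equiv> tangent_slope h"

text \<open>The value function: the cost of bringing the perpetuity from \<open>0\<close> to \<open>x\<close> when each unit of growth at level \<open>y\<close> is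
  paid at the price \<open>p y\<close>.\<close>

abbreviation "V \<equiv> cumulative p"

lemma rate_pos: "rate > 0"
  using \<gamma>_gt_1 by (simp add: rate_def)

lemma h_eventually_pos: "\<forall>\<^sub>F x in at_top. h x > 0"
  using h_at_top by (simp add: filterlim_at_top_dense)

lemma p_nonneg: "0 \<le> p y"
  by (rule tangent_slope_nonneg[OF h_nonneg])

lemma p_mono: "mono p"
  by (rule tangent_slope_mono[OF h_nonneg])

lemma p_asymp: "((\<lambda>y. p y * y / h y) \<longlongrightarrow> \<gamma> * rate) at_top"
  unfolding rate_def by (rule tangent_slope_asymp[OF h_index h_nonneg h_mono \<gamma>_gt_1])

lemma p_index: "varies_with_index (\<gamma> - 1) p"
  unfolding varies_with_index_def
proof (intro allI impI)
  fix t :: real assume t: "t > 0"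
  have K: "\<gamma> * rate \<noteq> 0" using rate_pos \<gamma>_gt_1 by simp
  have fl: "filterlim (\<lambda>x. t * x) at_top at_top" using t by real_asymp
  have "((\<lambda>y. (p (t * y) * (t * y) / h (t * y)) * (h (t * y) / h y) / (p y * y / h y) / t)
      \<longlongrightarrow> (\<gamma> * rate) * t powr \<gamma> / (\<gamma> * rate) / t) at_top"
    using K t by (intro tendsto_intros p_asymp filterlim_compose[OF p_asymp fl] varies_with_indexD[OF h_index]) auto
  also have "(\<gamma> * rate) * t powr \<gamma> / (\<gamma> * rate) / t = t powr (\<gamma> - 1)"
    using K t by (simp add: powr_diff)
  finally have *: "((\<lambda>y. (p (t * y) * (t * y) / h (t * y)) * (h (t * y) / h y) / (p y * y / h y) / t)
      \<longlongrightarrow> t powr (\<gamma> - 1)) at_top" .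
  show "((\<lambda>y. p (t * y) / p y) \<longlongrightarrow> t powr (\<gamma> - 1)) at_top"
  proof (rule Lim_transform_eventually[OF *])
    show "\<forall>\<^sub>F y in at_top. (p (t * y) * (t * y) / h (t * y)) * (h (t * y) / h y) / (p y * y / h y) / t = p (t * y) / p y"
      using h_eventually_pos eventually_compose_filterlim[OF h_eventually_pos fl] eventually_gt_at_top[of 0]
      by eventually_elim (use t in \<open>simp add: field_simps\<close>)
  qed
qed

lemma p_at_top: "filterlim p at_top at_top"
  using index_at_top[OF p_index p_nonneg p_mono] \<gamma>_gt_1 by simp

lemma V_asymp: "((\<lambda>x. V x / h x) \<longlongrightarrow> rate) at_top"
proof -
  have "((\<lambda>x. V x / (x * p x)) \<longlongrightarrow> 1 / (\<gamma> - 1 + 1)) at_top"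
    using \<gamma>_gt_1 by (intro Karamata_monotone p_index p_nonneg p_mono) auto
  from tendsto_mult[OF this p_asymp]
  have *: "((\<lambda>x. V x / (x * p x) * (p x * x / h x)) \<longlongrightarrow> rate) at_top"
    using \<gamma>_gt_1 by simp
  have "\<forall>\<^sub>F x in at_top. p x > 0" using p_at_top by (simp add: filterlim_at_top_dense)
  with eventually_gt_at_top[of 0] have "\<forall>\<^sub>F x in at_top. V x / (x * p x) * (p x * x / h x) = V x / h x"
    by eventually_elim (simp add: field_simps)
  with * show ?thesis by (rule Lim_transform_eventually)
qed

lemma V_mono: "mono V"
  by (rule cumulative_mono[OF p_mono p_nonneg])

lemma V_zero: "V 0 = 0"
  by (simp add: cumulative_nonpos)

lemma V_nonneg: "0 \<le> V x"
  using monoD[OF V_mono, of 0 x] by (cases "0 \<le> x") (auto simp: V_zero cumulative_nonpos)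

lemma V_increment_ge: "0 \<le> a \<Longrightarrow> a \<le> b \<Longrightarrow> p a * (b - a) \<le> V b - V a"
  and V_increment_le: "0 \<le> a \<Longrightarrow> a \<le> b \<Longrightarrow> V b - V a \<le> p b * (b - a)"
  by (rule cumulative_increment[OF p_mono]; assumption)+

lemma V_le_h: "0 < x \<Longrightarrow> V x \<le> h (2 * x)"
  using V_increment_le[of 0 x] tangent_slope_le[of h x "2 * x", OF h_nonneg]
  by (simp add: V_zero field_simps)

lemma V_le_small_k:
  assumes "K > 0" "e > 0"
  shows "\<forall>\<^sub>F q in at_top. V (K * q) \<le> e * k q"
proof -
  have "\<forall>\<^sub>F q in at_top. h (2 * K * q) \<le> e * k q"
    using assms by (intro h_le_small_k) auto
  then show ?thesis using eventually_gt_at_top[of 0]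
  proof eventually_elim
    case (elim q)
    then show ?case using V_le_h[of "K * q"] assms by (simp add: mult.assoc)
  qed
qed

text \<open>A step with parameters \<open>\<mu>\<close>, \<open>q\<close> moves the level from \<open>y\<close> to \<open>\<mu> * y + q\<close>; its cost is at least \<open>p y\<close> times the
  gain. With \<open>t = 1 / (1 - \<mu>)\<close>, the definition of \<open>h\<close> bounds the cost below by \<open>h (t * q) / t\<close>, and the gain is
  \<open>(t * q - y) / t\<close>, so the quotient is a chord slope from \<open>(y, 0)\<close>.\<close>

lemma slope_times_gain_le_cost:
  assumes "0 \<le> \<mu>" "\<mu> < 1"
  shows "p y * (q - (1 - \<mu>) * y) \<le> m (1 / (1 - \<mu>)) + k q"
proof (cases "q \<le> (1 - \<mu>) * y")
  case True
  then have "p y * (q - (1 - \<mu>) * y) \<le> 0" using p_nonneg[of y] by (simp add: mult_nonneg_nonpos)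
  then show ?thesis using m_nonneg[of "1 / (1 - \<mu>)"] k_nonneg[of q] by linarith
next
  case False
  define T where "T = 1 / (1 - \<mu>)"
  have T: "T \<ge> 1" "1 - \<mu> = 1 / T" using assms by (auto simp: T_def field_simps)
  have gt: "y < T * q" using False T by (simp add: field_simps)
  have "p y \<le> h (T * q) / (T * q - y)" by (rule tangent_slope_le[OF h_nonneg gt])
  then have "p y * (T * q - y) \<le> h (T * q)" using gt by (simp add: field_simps)
  also have "\<dots> \<le> T * (m T + k (T * q / T))" by (rule h_le[OF T(1)])
  also have "T * q / T = q" using T(1) by simp
  also have "p y * (T * q - y) = T * (p y * (q - y / T))" using T(1) by (simp add: field_simps)
  finally have "T * (p y * (q - y / T)) \<le> T * (m T + k q)" .
  then have "p y * (q - y / T) \<le> m T + k q" using T by (simp add: mult_le_cancel_left_pos)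
  then show ?thesis using T unfolding T_def[symmetric] by simp
qed

text \<open>Let \<open>D\<close> be the gain of the step and \<open>Z\<close> its cost. If \<open>D \<le> -1\<close>, then \<open>V\<close> drops by at least \<open>p (y - 1)\<close>. Otherwise \<open>Z\<close>
  is at least \<open>J y\<close>, which is large, and \<open>(1 - e)\<close> times the increase of \<open>V\<close> is at most \<open>(1 - e / 2) * Z\<close>: for gains that are small
  relative to \<open>y\<close> because \<open>p\<close> hardly changes between \<open>y\<close> and \<open>y + D\<close>, for larger ones because \<open>q\<close> is then
  of order at least \<open>y\<close> and \<open>k q\<close> outgrows \<open>V\<close>. A part \<open>(e / 4) * Z\<close> of the slack is traded for the
  small factor, and the rest leaves an exponential moment of \<open>Z\<close> of order below 1.\<close>

lemma drift_pointwise: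
  assumes e: "0 < e" "e < 1"
  obtains J where "filterlim J at_top at_top"
    "\<forall>\<^sub>F y in at_top. \<forall>\<mu> q. 0 \<le> \<mu> \<longrightarrow> \<mu> < 1 \<longrightarrow> 0 \<le> q \<longrightarrow>
       exp ((1 - e) * (V (\<mu> * y + q) - V y))
         \<le> exp (- (1 - e) * p (y - 1)) + exp (- (e / 4) * J y) * exp ((1 - e / 4) * (m (1 / (1 - \<mu>)) + k q))"
proof -
  define J where "J y = min (m (sqrt y)) (k (sqrt y - 1))" for y
  have s: "filterlim sqrt at_top at_top" by (rule sqrt_at_top)
  have s1: "filterlim (\<lambda>y. sqrt y - 1) at_top at_top" by real_asymp
  have J: "filterlim J at_top at_top"
    unfolding J_def filterlim_at_top
    using filterlim_compose[OF m_at_top s] filterlim_compose[OF k_at_top s1]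
    by (auto simp: filterlim_at_top intro: eventually_conj)
  define B where "B = (1 - e / 2) / (1 - e)"
  have B: "B > 1" "(1 - e) * B = 1 - e / 2" using e by (auto simp: B_def field_simps)
  have "((\<lambda>d. (1 + d) powr (\<gamma> - 1)) \<longlongrightarrow> (1 + 0) powr (\<gamma> - 1)) (at_right (0::real))"
    by (intro tendsto_intros) auto
  then have "\<forall>\<^sub>F d::real in at_right 0. (1 + d) powr (\<gamma> - 1) < B"
    using B by (intro order_tendstoD) auto
  moreover have "\<forall>\<^sub>F d::real in at_right 0. d > 0" by (simp add: eventually_at_filter)
  ultimately have "\<forall>\<^sub>F d::real in at_right 0. (1 + d) powr (\<gamma> - 1) < B \<and> d > 0" by eventually_elim auto
  then obtain d :: real where d: "(1 + d) powr (\<gamma> - 1) < B" "d > 0"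
    using eventually_happens'[OF trivial_limit_at_right_real] by blast
  have pB: "\<forall>\<^sub>F y in at_top. p ((1 + d) * y) \<le> B * p y"
    using d by (intro index_eventually_le[OF p_index p_nonneg]) auto
  have "\<forall>\<^sub>F q in at_top. V ((1 + 1 / d) * q) \<le> 1/2 * k q"
    using d by (intro V_le_small_k) (auto intro: add_pos_pos)
  then obtain q0 where q0: "\<And>q. q \<ge> q0 \<Longrightarrow> V ((1 + 1 / d) * q) \<le> 1/2 * k q"
    by (auto simp: eventually_at_top_linorder)
  have "\<forall>\<^sub>F y in at_top. \<forall>\<mu> q. 0 \<le> \<mu> \<longrightarrow> \<mu> < 1 \<longrightarrow> 0 \<le> q \<longrightarrow>
       exp ((1 - e) * (V (\<mu> * y + q) - V y))
         \<le> exp (- (1 - e) * p (y - 1)) + exp (- (e / 4) * J y) * exp ((1 - e / 4) * (m (1 / (1 - \<mu>)) + k q))"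
    using pB eventually_ge_at_top[of 1] eventually_ge_at_top[of "q0 / d"]
  proof eventually_elim
    case (elim y)
    show ?case
    proof (intro allI impI)
      fix \<mu> q :: real assume \<mu>: "0 \<le> \<mu>" "\<mu> < 1" and q: "0 \<le> q"
      define Z where "Z = m (1 / (1 - \<mu>)) + k q"
      define D where "D = q - (1 - \<mu>) * y"
      have Z: "Z \<ge> 0" "k q \<le> Z" using m_nonneg k_nonneg by (auto simp: Z_def)
      have yD: "\<mu> * y + q = y + D" by (simp add: D_def algebra_simps)
      have yD0: "0 \<le> y + D" unfolding yD[symmetric] using \<mu> q elim by simp
      have key: "p y * D \<le> Z" unfolding D_def Z_def by (rule slope_times_gain_le_cost[OF \<mu>])
      have "exp ((1 - e) * (V (y + D) - V y)) \<le> exp (- (1 - e) * p (y - 1)) + exp (- (e / 4) * J y) * exp ((1 - e / 4) * Z)"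
      proof (cases "D \<le> -1")
        case True
        have "V (y + D) \<le> V (y - 1)" using True by (intro monoD[OF V_mono]) auto
        moreover have "p (y - 1) * (y - (y - 1)) \<le> V y - V (y - 1)"
          using elim by (intro V_increment_ge) auto
        ultimately have "V (y + D) - V y \<le> - p (y - 1)" by simp
        then have "(1 - e) * (V (y + D) - V y) \<le> (1 - e) * (- p (y - 1))"
          using e by (intro mult_left_mono) auto
        then have "exp ((1 - e) * (V (y + D) - V y)) \<le> exp (- (1 - e) * p (y - 1))" by (simp add: algebra_simps)
        then show ?thesis by (simp add: add_increasing2)
      next
        case False
        have JZ: "J y \<le> Z"
        proof (cases "sqrt y \<le> 1 / (1 - \<mu>)")
          case True
          then show ?thesis using monoD[OF m_mono True] k_nonneg[of q] by (auto simp: J_def Z_def)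
        next
          case F: False
          then have "sqrt y * (1 - \<mu>) \<ge> 1" using \<mu> by (simp add: field_simps)
          then have "sqrt y * 1 \<le> sqrt y * (sqrt y * (1 - \<mu>))" using elim by (intro mult_left_mono) auto
          also have "\<dots> = y * (1 - \<mu>)" using elim by (simp flip: mult.assoc)
          also have "\<dots> < q + 1" using False by (simp add: D_def algebra_simps)
          finally have "sqrt y - 1 \<le> q" by simp
          from monoD[OF k_mono this] show ?thesis using m_nonneg[of "1 / (1 - \<mu>)"] by (auto simp: J_def Z_def)
        qed
        have "(1 - e) * (V (y + D) - V y) \<le> (1 - e / 2) * Z"
        proof (cases "D \<le> d * y")
          case True
          have "V (y + D) - V y \<le> B * Z"
          proof (cases "D \<le> 0")
            case True
            then have "V (y + D) \<le> V y" by (intro monoD[OF V_mono]) auto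
            then show ?thesis using B Z by (smt (verit) mult_nonneg_nonneg)
          next
            case D: False
            have "V (y + D) - V y \<le> p (y + D) * (y + D - y)"
              using D elim by (intro V_increment_le) auto
            also have "\<dots> \<le> p ((1 + d) * y) * D"
              using D True by (auto intro!: mult_right_mono monoD[OF p_mono] simp: algebra_simps)
            also have "\<dots> \<le> B * p y * D" using D elim by (intro mult_right_mono) auto
            also have "\<dots> \<le> B * Z" using B key by (simp add: mult.assoc)
            finally show ?thesis .
          qed
          then have "(1 - e) * (V (y + D) - V y) \<le> (1 - e) * (B * Z)"
            using e by (intro mult_left_mono) auto
          then show ?thesis using B by (simp flip: mult.assoc)
        next
          case False
          have Dq: "D \<le> q" unfolding D_def using \<mu> elim by simp
          have "d * y \<le> q" using False Dq by simp
          then have yq: "y \<le> 1 / d * q" using d by (simp add: field_simps)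
          have "q0 \<le> d * y" using elim d by (simp add: field_simps)
          then have "q0 \<le> q" using \<open>d * y \<le> q\<close> by simp
          have "V (y + D) \<le> V ((1 + 1 / d) * q)"
            using yq Dq by (intro monoD[OF V_mono]) (simp add: algebra_simps)
          also have "\<dots> \<le> 1/2 * k q" by (rule q0[OF \<open>q0 \<le> q\<close>])
          finally have "V (y + D) - V y \<le> 1/2 * Z" using V_nonneg[of y] Z by simp
          then have "(1 - e) * (V (y + D) - V y) \<le> (1 - e) * (1/2 * Z)"
            using e by (intro mult_left_mono) auto
          also have "\<dots> \<le> (1 - e / 2) * Z" using e Z by (simp add: field_simps)
          finally show ?thesis .
        qed
        also have "(1 - e / 2) * Z = - (e / 4) * Z + (1 - e / 4) * Z" by (simp add: algebra_simps)
        also have "\<dots> \<le> - (e / 4) * J y + (1 - e / 4) * Z"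
          using JZ e by (intro add_right_mono mult_left_mono_neg) auto
        finally have "exp ((1 - e) * (V (y + D) - V y)) \<le> exp (- (e / 4) * J y) * exp ((1 - e / 4) * Z)"
          by (simp add: mult_exp_exp)
        then show ?thesis by (simp add: add_increasing)
      qed
      then show "exp ((1 - e) * (V (\<mu> * y + q) - V y))
         \<le> exp (- (1 - e) * p (y - 1)) + exp (- (e / 4) * J y) * exp ((1 - e / 4) * (m (1 / (1 - \<mu>)) + k q))"
        by (simp add: yD Z_def)
    qed
  qed
  with J show ?thesis by (rule that)
qed

text \<open>The Lyapunov condition for \<open>exp ((1 - e) * V)\<close>: integrating the pointwise bound, both terms tend to zero, the first since
  \<open>p\<close> and the second since \<open>J\<close> tends to infinity.\<close>

lemma drift_to_half:
  fixes P :: "'a measure"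
  assumes "prob_space P"
    and [measurable]: "M \<in> borel_measurable P" "Q \<in> borel_measurable P"
    and ae: "AE \<omega> in P. 0 \<le> M \<omega> \<and> M \<omega> < 1 \<and> 0 \<le> Q \<omega>"
    and int: "\<And>e. 0 < e \<Longrightarrow> e < 1 \<Longrightarrow> integrable P (\<lambda>\<omega>. exp ((1 - e) * (m (1 / (1 - M \<omega>)) + k (Q \<omega>))))"
    and e: "0 < e" "e < 1"
  shows "\<forall>\<^sub>F y in at_top. integrable P (\<lambda>\<omega>. exp ((1 - e) * V (M \<omega> * y + Q \<omega>))) \<and>
           (\<integral>\<omega>. exp ((1 - e) * V (M \<omega> * y + Q \<omega>)) \<partial>P) \<le> exp ((1 - e) * V y) / 2"
proof -
  interpret prob_space P by fact
  have [measurable]: "V \<in> borel_measurable borel" by (rule borel_measurable_mono[OF V_mono])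
  have [measurable]: "m \<in> borel_measurable borel" by (rule borel_measurable_mono[OF m_mono])
  have [measurable]: "k \<in> borel_measurable borel" by (rule borel_measurable_mono[OF k_mono])
  define E where "E = (\<lambda>\<omega>. exp ((1 - e / 4) * (m (1 / (1 - M \<omega>)) + k (Q \<omega>))))"
  have E: "integrable P E" unfolding E_def using e by (intro int) auto
  obtain J where J: "filterlim J at_top at_top" and
    ptw: "\<forall>\<^sub>F y in at_top. \<forall>\<mu> q. 0 \<le> \<mu> \<longrightarrow> \<mu> < 1 \<longrightarrow> 0 \<le> q \<longrightarrow>
       exp ((1 - e) * (V (\<mu> * y + q) - V y))
         \<le> exp (- (1 - e) * p (y - 1)) + exp (- (e / 4) * J y) * exp ((1 - e / 4) * (m (1 / (1 - \<mu>)) + k q))"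
    using drift_pointwise[OF e] by blast
  have "((\<lambda>z::real. exp (- (1 - e) * z)) \<longlongrightarrow> 0) at_top" using e by real_asymp
  moreover have "filterlim (\<lambda>y::real. y - 1) at_top at_top" by real_asymp
  ultimately have "((\<lambda>y. exp (- (1 - e) * p (y - 1))) \<longlongrightarrow> 0) at_top"
    by (rule filterlim_compose[OF _ filterlim_compose[OF p_at_top]])
  moreover have "((\<lambda>z::real. exp (- (e / 4) * z)) \<longlongrightarrow> 0) at_top" using e by real_asymp
  from filterlim_compose[OF this J] have "((\<lambda>y. exp (- (e / 4) * J y)) \<longlongrightarrow> 0) at_top" .
  ultimately have "((\<lambda>y. exp (- (1 - e) * p (y - 1)) + exp (- (e / 4) * J y) * (\<integral>\<omega>. E \<omega> \<partial>P)) \<longlongrightarrow> 0 + 0 * (\<integral>\<omega>. E \<omega> \<partial>P)) at_top"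
    by (intro tendsto_intros)
  then have "\<forall>\<^sub>F y in at_top. exp (- (1 - e) * p (y - 1)) + exp (- (e / 4) * J y) * (\<integral>\<omega>. E \<omega> \<partial>P) < 1/2"
    by (intro order_tendstoD) auto
  with ptw show ?thesis
  proof eventually_elim
    case (elim y)
    define G where "G = (\<lambda>\<omega>. exp ((1 - e) * V y) * (exp (- (1 - e) * p (y - 1)) + exp (- (e / 4) * J y) * E \<omega>))"
    have G: "integrable P G" unfolding G_def using E by simp
    have le: "AE \<omega> in P. exp ((1 - e) * V (M \<omega> * y + Q \<omega>)) \<le> G \<omega>"
      using ae
    proof eventually_elim
      case (elim \<omega>)
      then have "exp ((1 - e) * (V (M \<omega> * y + Q \<omega>) - V y)) \<le> exp (- (1 - e) * p (y - 1)) + exp (- (e / 4) * J y) * E \<omega>"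
        using \<open>\<forall>\<mu> q. _ \<mu> q\<close> unfolding E_def by blast
      then have "exp ((1 - e) * V y) * exp ((1 - e) * (V (M \<omega> * y + Q \<omega>) - V y)) \<le> G \<omega>"
        unfolding G_def by (intro mult_left_mono) auto
      then show ?case by (simp add: mult_exp_exp algebra_simps)
    qed
    have int: "integrable P (\<lambda>\<omega>. exp ((1 - e) * V (M \<omega> * y + Q \<omega>)))"
      by (rule Bochner_Integration.integrable_bound[OF G]) (use le in \<open>auto\<close>)
    have "(\<integral>\<omega>. exp ((1 - e) * V (M \<omega> * y + Q \<omega>)) \<partial>P) \<le> (\<integral>\<omega>. G \<omega> \<partial>P)"
      by (rule integral_mono_AE[OF int G le])
    also have "\<dots> = exp ((1 - e) * V y) * (exp (- (1 - e) * p (y - 1)) + exp (- (e / 4) * J y) * (\<integral>\<omega>. E \<omega> \<partial>P))"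
      unfolding G_def using E by (simp add: prob_space)
    also have "\<dots> \<le> exp ((1 - e) * V y) * (1 / 2)" using elim by (intro mult_left_mono) auto
    finally show ?case using int by simp
  qed
qed

end

section \<open>Climbing by efficient steps and weighted costs\<close>

context regular_costs
begin

lemma near_minimizer_exists:
  assumes "0 < h x" "1 < C"
  obtains t where "1 \<le> t" "t * (m t + k (x / t)) \<le> C * h x"
proof -
  have "\<exists>t\<ge>1. t * (m t + k (x / t)) \<le> C * h x"
  proof (rule ccontr)
    assume "\<not> ?thesis"
    then have "C * h x \<le> h x" by (intro perp_cost_greatest) (metis linear)
    then show False using assms by simp
  qed
  then show ?thesis using that by blast
qed

text \<open>The converse of \<open>slope_times_gain_le_cost\<close> up to a factor \<open>E\<close>: take \<open>x = w * y\<close> at the asymptotically optimal chord, a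
  near-minimizer \<open>t\<close> for \<open>h x\<close>, and \<open>q = x / t\<close>. The gain \<open>(w - 1) * y / t\<close> is small relative to \<open>y\<close> because \<open>t\<close> is large, and
  bounded below because \<open>x / t\<close> is.\<close>

lemma efficient_step:
  assumes "1 < E" "0 < d"
  obtains d0 where "d0 > 0"
    "\<forall>\<^sub>F y in at_top. \<exists>t\<ge>1. \<exists>q\<ge>0. d0 \<le> q - y / t \<and> q - y / t \<le> d * y \<and>
        m t + k q \<le> E * (V (y + (q - y / t)) - V y)"
proof -
  define w where "w = \<gamma> / (\<gamma> - 1)"
  have w: "w > 1" using \<gamma>_gt_1 by (auto simp: w_def)
  have wrate: "w powr \<gamma> = \<gamma> * rate * (w - 1)"
    unfolding rate_def w_def by (rule touching_point_value[OF \<gamma>_gt_1])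
  (* The error E is split evenly between the chord and the near-minimizer; the cap 2 is the range of near_minimizers. *)
  define c where "c = min 2 (sqrt E)"
  have c: "1 < c" "c \<le> 2" "c * c \<le> E"
  proof -
    show "1 < c" "c \<le> 2" using assms by (auto simp: c_def)
    have "c * c \<le> sqrt E * sqrt E" using \<open>1 < c\<close> by (intro mult_mono) (auto simp: c_def)
    then show "c * c \<le> E" using assms by simp
  qed
  have K: "\<gamma> * rate > 0" using rate_pos \<gamma>_gt_1 by simp
  have "((\<lambda>y. (h (w * y) / h y) / (p y * y / h y)) \<longlongrightarrow> w powr \<gamma> / (\<gamma> * rate)) at_top"
    using K w by (intro tendsto_intros p_asymp varies_with_indexD[OF h_index]) auto
  moreover have "w powr \<gamma> / (\<gamma> * rate) < c * (w - 1)"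
    unfolding wrate using K c w by simp
  ultimately have hp: "\<forall>\<^sub>F y in at_top. (h (w * y) / h y) / (p y * y / h y) < c * (w - 1)"
    by (rule order_tendstoD)
  have ppos: "\<forall>\<^sub>F x in at_top. p x > 0" using p_at_top by (simp add: filterlim_at_top_dense)
  have fl: "filterlim (\<lambda>x. w * x) at_top at_top" using w by real_asymp
  have nm: "\<forall>\<^sub>F y in at_top. \<forall>t\<ge>1. t * (m t + k (w * y / t)) \<le> 2 * h (w * y) \<longrightarrow> max 1 ((w - 1) / d) \<le> t \<and> 1 \<le> w * y / t"
    by (rule eventually_compose_filterlim[OF near_minimizers fl]) auto
  define d0 where "d0 = (w - 1) / w"
  have d0: "d0 > 0" using w by (simp add: d0_def)
  have "\<forall>\<^sub>F y in at_top. \<exists>t\<ge>1. \<exists>q\<ge>0. d0 \<le> q - y / t \<and> q - y / t \<le> d * y \<and>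
        m t + k q \<le> E * (V (y + (q - y / t)) - V y)"
    using hp nm ppos h_eventually_pos eventually_compose_filterlim[OF h_eventually_pos fl] eventually_gt_at_top[of 0]
  proof eventually_elim
    case (elim y)
    obtain t where t: "1 \<le> t" "t * (m t + k (w * y / t)) \<le> c * h (w * y)"
      using near_minimizer_exists[of "w * y" c] elim c by blast
    have "c * h (w * y) \<le> 2 * h (w * y)" using c elim by simp
    then have loc: "(w - 1) / d \<le> t" "1 \<le> w * y / t" using elim(2) t by auto
    define D where "D = w * y / t - y / t"
    have D: "D = (w - 1) * y / t" by (simp add: D_def diff_divide_distrib algebra_simps)
    have "d0 * 1 \<le> (w - 1) / w * (w * y / t)" unfolding d0_def using loc w by (intro mult_left_mono) auto
    then have D1: "d0 \<le> D" using w by (simp add: D)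
    have "(w - 1) / t \<le> d" using loc assms t by (simp add: field_simps)
    then have "(w - 1) / t * y \<le> d * y" using elim by (intro mult_right_mono) auto
    then have D2: "D \<le> d * y" by (simp add: D)
    have "h (w * y) \<le> c * (w - 1) * (p y * y)"
      using elim by (simp add: field_simps)
    then have "c * h (w * y) \<le> c * (c * (w - 1) * (p y * y))" using c by (intro mult_left_mono) auto
    with t(2) have "t * (m t + k (w * y / t)) \<le> c * c * ((w - 1) * (p y * y))" by (simp add: mult_ac)
    also have "\<dots> \<le> E * ((w - 1) * (p y * y))"
      using c w elim by (intro mult_right_mono) auto
    also have "\<dots> = t * (E * (p y * D))" using t by (simp add: D)
    finally have "m t + k (w * y / t) \<le> E * (p y * D)" using t by simp
    also have "p y * D \<le> V (y + D) - V y"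
      using V_increment_ge[of y "y + D"] elim D1 d0 by simp
    finally have "m t + k (w * y / t) \<le> E * (V (y + D) - V y)" using assms by simp
    then show ?case using t(1) D1 D2 elim w unfolding D_def
      by (intro exI[of _ t] conjI exI[of _ "w * y / t"]) auto
  qed
  with d0 show ?thesis by (rule that)
qed

text \<open>Efficient steps never increase \<open>g - (1 + e) * V\<close>. They gain at least \<open>d0\<close> each, hence lead from a fixed \<open>Y\<close> past any
  \<open>x\<close>, and since a step gains at most \<open>e * y\<close>, they overshoot \<open>x\<close> by a factor of at most \<open>1 + e\<close>.\<close>

lemma cost_upper_bound_by_steps:
  fixes g :: "real \<Rightarrow> real"
  assumes g_mono: "mono g"
    and step: "\<And>y t q. 0 \<le> y \<Longrightarrow> 1 \<le> t \<Longrightarrow> 0 \<le> q \<Longrightarrow> g (y + (q - y / t)) \<le> g y + (m t + k q)"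
    and B: "rate < B"
  shows "\<forall>\<^sub>F x in at_top. g x \<le> B * h x"
proof -
  have "((\<lambda>e. (1 + e) * (rate * (1 + e) powr \<gamma>)) \<longlongrightarrow> (1 + 0) * (rate * (1 + 0) powr \<gamma>)) (at_right (0::real))"
    by (intro tendsto_intros) auto
  then have "\<forall>\<^sub>F e::real in at_right 0. (1 + e) * (rate * (1 + e) powr \<gamma>) < B"
    using B by (intro order_tendstoD) auto
  moreover have "\<forall>\<^sub>F d::real in at_right 0. d > 0" by (simp add: eventually_at_filter)
  ultimately have "\<forall>\<^sub>F e::real in at_right 0. (1 + e) * (rate * (1 + e) powr \<gamma>) < B \<and> e > 0"
    by eventually_elim auto
  then obtain e :: real where e: "(1 + e) * (rate * (1 + e) powr \<gamma>) < B" "e > 0"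
    using eventually_happens'[OF trivial_limit_at_right_real] by blast
  obtain d0 where d0: "d0 > 0" and
    "\<forall>\<^sub>F y in at_top. \<exists>t\<ge>1. \<exists>q\<ge>0. d0 \<le> q - y / t \<and> q - y / t \<le> e * y \<and>
        m t + k q \<le> (1 + e) * (V (y + (q - y / t)) - V y)"
    using efficient_step[of "1 + e" e] e by auto
  then obtain Y0 where Y0: "\<And>y. y \<ge> Y0 \<Longrightarrow> \<exists>t\<ge>1. \<exists>q\<ge>0. d0 \<le> q - y / t \<and> q - y / t \<le> e * y \<and>
        m t + k q \<le> (1 + e) * (V (y + (q - y / t)) - V y)"
    by (auto simp: eventually_at_top_linorder)
  define Y where "Y = max 0 Y0"
  define \<Phi> where "\<Phi> z = g z - (1 + e) * V z" for z
  have move: "\<exists>D. d0 \<le> D \<and> D \<le> e * y \<and> \<Phi> (y + D) \<le> \<Phi> y" if "y \<ge> Y" for y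
  proof -
    obtain t q where tq: "1 \<le> t" "0 \<le> q" "d0 \<le> q - y / t" "q - y / t \<le> e * y"
        "m t + k q \<le> (1 + e) * (V (y + (q - y / t)) - V y)"
      using Y0[of y] \<open>y \<ge> Y\<close> by (auto simp: Y_def)
    have "g (y + (q - y / t)) \<le> g y + (m t + k q)" using step tq \<open>y \<ge> Y\<close> by (auto simp: Y_def)
    also have "\<dots> \<le> g y + (1 + e) * (V (y + (q - y / t)) - V y)" using tq by simp
    finally have "\<Phi> (y + (q - y / t)) \<le> \<Phi> y" by (simp add: \<Phi>_def right_diff_distrib)
    with tq show ?thesis by blast
  qed
  have reach: "\<exists>z. x \<le> z \<and> z \<le> (1 + e) * x \<and> \<Phi> z \<le> \<Phi> Y" if "Y \<le> x" "x \<le> Y + real n * d0" for x n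
    using that
  proof (induction n arbitrary: x)
    case 0
    then have "x = Y" by simp
    moreover have "Y \<le> (1 + e) * Y" using e by (simp add: Y_def algebra_simps)
    ultimately show ?case by blast
  next
    case (Suc n)
    define x' where "x' = max Y (x - d0)"
    have x': "Y \<le> x'" "x - d0 \<le> x'" "x' \<le> x" "x' \<le> Y + real n * d0"
      using Suc.prems d0 by (auto simp: x'_def algebra_simps)
    obtain z where z: "x' \<le> z" "z \<le> (1 + e) * x'" "\<Phi> z \<le> \<Phi> Y" using Suc.IH[OF x'(1,4)] by blast
    show ?case
    proof (cases "x \<le> z")
      case True
      have "(1 + e) * x' \<le> (1 + e) * x" using x' e by (intro mult_left_mono) auto
      then show ?thesis using z True by (intro exI[of _ z]) auto
    next
      case False
      obtain D where D: "d0 \<le> D" "D \<le> e * z" "\<Phi> (z + D) \<le> \<Phi> z" using move[of z] z x' by auto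
      have "z + D \<le> (1 + e) * z" using D by (simp add: algebra_simps)
      also have "\<dots> \<le> (1 + e) * x" using False e by (intro mult_left_mono) auto
      finally show ?thesis using D z x' by (intro exI[of _ "z + D"]) auto
    qed
  qed
  have bound: "g x \<le> \<Phi> Y + (1 + e) * V ((1 + e) * x)" if x: "Y \<le> x" for x
  proof -
    obtain n :: nat where "(x - Y) / d0 \<le> real n" using real_arch_simple by blast
    then have "x \<le> Y + real n * d0" using d0 by (simp add: field_simps)
    then obtain z where z: "x \<le> z" "z \<le> (1 + e) * x" "\<Phi> z \<le> \<Phi> Y" using reach x by blast
    have "g x \<le> g z" using g_mono z by (auto dest: monoD)
    also have "\<dots> \<le> \<Phi> Y + (1 + e) * V z" using z by (simp add: \<Phi>_def)
    also have "\<dots> \<le> \<Phi> Y + (1 + e) * V ((1 + e) * x)"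
      using z e by (intro add_left_mono mult_left_mono monoD[OF V_mono]) auto
    finally show ?thesis .
  qed
  have fl: "filterlim (\<lambda>x. (1 + e) * x) at_top at_top" using e by real_asymp
  have "((\<lambda>x. \<Phi> Y / h x + (1 + e) * ((V ((1 + e) * x) / h ((1 + e) * x)) * (h ((1 + e) * x) / h x)))
     \<longlongrightarrow> 0 + (1 + e) * (rate * (1 + e) powr \<gamma>)) at_top"
    using e by (intro tendsto_intros filterlim_compose[OF V_asymp fl] varies_with_indexD[OF h_index]
        tendsto_divide_0[OF tendsto_const] filterlim_at_top_imp_at_infinity[OF h_at_top]) auto
  then have "\<forall>\<^sub>F x in at_top. \<Phi> Y / h x + (1 + e) * ((V ((1 + e) * x) / h ((1 + e) * x)) * (h ((1 + e) * x) / h x)) < B"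
    using e by (intro order_tendstoD) auto
  then show ?thesis
    using h_eventually_pos eventually_compose_filterlim[OF h_eventually_pos fl] eventually_ge_at_top[of Y]
  proof eventually_elim
    case (elim x)
    then have "\<Phi> Y / h x + (1 + e) * (V ((1 + e) * x) / h x) < B" by simp
    then have "\<Phi> Y + (1 + e) * V ((1 + e) * x) < B * h x"
      using elim by (simp add: add_divide_distrib[symmetric] pos_divide_less_eq)
    then show ?case using bound[of x] elim by simp
  qed
qed

lemma weighted_regular_costs:
  assumes "a > 0" "b > 0"
  shows "regular_costs (\<lambda>t. a * m t) (\<lambda>q. b * k q) \<alpha> r"
proof
  show "mono (\<lambda>t. a * m t)" "mono (\<lambda>q. b * k q)"
    using assms m_mono k_mono by (auto simp: mono_def)
qed (use assms m_nonneg k_nonneg m_index k_index r_gt_1 \<alpha>_gt_1 in \<open>auto intro: index_cmult\<close>)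

text \<open>Replacing \<open>t\<close> by \<open>\<rho> * t\<close> multiplies the two terms of the infimum by about \<open>\<rho> powr r\<close> and \<open>\<rho> powr (1 - \<alpha>)\<close>.
  The \<open>\<rho>\<close> with \<open>\<rho> powr (\<alpha> + r - 1) = a / b\<close> makes them proportional to the weights.\<close>

lemma cost_le_weighted_cost:
  assumes ab: "a > 0" "b > 0" and A: "1 / (a * (b / a) powr (r / (\<alpha> + r - 1))) < A"
  shows "\<forall>\<^sub>F x in at_top. h x \<le> A * perp_cost (\<lambda>t. a * m t) (\<lambda>q. b * k q) x"
proof -
  interpret weighted: regular_costs "\<lambda>t. a * m t" "\<lambda>q. b * k q" \<alpha> r
    by (rule weighted_regular_costs[OF ab])
  define s where "s = \<alpha> + r - 1"
  have s: "s > 0" using \<alpha>_gt_1 r_gt_1 by (simp add: s_def)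
  define \<rho> where "\<rho> = (a / b) powr (1 / s)"
  have \<rho>: "\<rho> > 0" using ab by (simp add: \<rho>_def)
  have inv: "(b / a) powr (r / s) = 1 / (a / b) powr (r / s)"
    using ab by (simp add: powr_divide)
  have e1: "\<rho> * \<rho> powr (r - 1) = (a / b) powr (r / s)"
    using ab s by (simp add: \<rho>_def powr_powr powr_add[symmetric] diff_divide_distrib)
  have "\<rho> * (1 / \<rho>) powr \<alpha> = \<rho> powr (r - s)"
    using \<rho> by (simp add: powr_divide powr_diff powr_add s_def)
  also have "\<dots> = (a / b) powr (r / s - 1)"
    using s by (simp add: \<rho>_def powr_powr diff_divide_distrib)
  also have "\<dots> = (a / b) powr (r / s) * (b / a)"
    using ab by (simp add: powr_diff)
  finally have e2: "\<rho> * (1 / \<rho>) powr \<alpha> = (a / b) powr (r / s) * (b / a)" .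
  have Aa: "(a / b) powr (r / s) < A * a"
    using A ab unfolding s_def[symmetric] inv by (simp add: field_simps)
  have Apos: "A > 0" using A ab by (smt (verit) divide_pos_pos mult_pos_pos powr_gt_zero)
  have "\<forall>\<^sub>F x in at_top. perp_cost m k (\<rho> * (1 / \<rho>) * x) \<le> A * perp_cost (\<lambda>t. a * m t) (\<lambda>q. b * k q) x"
  proof (rule weighted.perp_cost_compare[OF m_nonneg k_nonneg \<rho> _ Apos])
    show "1 / \<rho> > 0" using \<rho> by simp
    have "\<rho> powr (r - 1) < A * a / \<rho>" using e1 Aa \<rho> by (simp add: field_simps)
    from index_eventually_le[OF m_index m_nonneg \<rho> this]
    show "\<forall>\<^sub>F t in at_top. \<rho> * m (\<rho> * t) \<le> A * (a * m t)" using \<rho> by (simp add: field_simps)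
    have "(a / b) powr (r / s) * (b / a) < A * a * (b / a)" using Aa ab by (intro mult_strict_right_mono) auto
    then have "\<rho> * (1 / \<rho>) powr \<alpha> < A * b" unfolding e2 using ab by simp
    then have "(1 / \<rho>) powr \<alpha> < A * b / \<rho>" using \<rho> by (simp add: pos_less_divide_eq mult.commute)
    from index_eventually_le[OF k_index k_nonneg _ this] \<rho>
    have "\<forall>\<^sub>F q in at_top. k (1 / \<rho> * q) \<le> A * b / \<rho> * k q" by simp
    then show "\<forall>\<^sub>F q in at_top. \<rho> * k (1 / \<rho> * q) \<le> A * (b * k q)" using \<rho> by (simp add: field_simps)
  qed
  then show ?thesis using \<rho> by simp
qed

end

section \<open>Exponential moments of tail costs\<close>

definition tail_cost :: "'a measure \<Rightarrow> ('a \<Rightarrow> real) \<Rightarrow> real \<Rightarrow> real" where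
  "tail_cost P X t = - ln (measure P {\<omega> \<in> space P. X \<omega> > t})"

context prob_space
begin

lemma tail_cost_nonneg:
  "0 \<le> tail_cost M X t"
  unfolding tail_cost_def
  by (cases "prob {\<omega> \<in> space M. X \<omega> > t} = 0") (auto simp: ln_le_zero_iff measure_nonneg less_le)

lemma tail_cost_mono:
  assumes [measurable]: "X \<in> borel_measurable M"
    and pos: "\<And>t. prob {\<omega> \<in> space M. X \<omega> > t} > 0"
  shows "mono (tail_cost M X)"
  unfolding tail_cost_def
proof (rule monoI, rule le_imp_neg_le)
  fix s t :: real assume "s \<le> t"
  then have "prob {\<omega> \<in> space M. X \<omega> > t} \<le> prob {\<omega> \<in> space M. X \<omega> > s}"
    by (intro finite_measure_mono) auto
  then show "ln (prob {\<omega> \<in> space M. X \<omega> > t}) \<le> ln (prob {\<omega> \<in> space M. X \<omega> > s})"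
    using pos by simp
qed

lemma exp_tail_cost:
  assumes "\<And>t. prob {\<omega> \<in> space M. X \<omega> > t} > 0"
  shows "prob {\<omega> \<in> space M. X \<omega> > t} = exp (- tail_cost M X t)"
  using assms by (simp add: tail_cost_def)

end

text \<open>A step function that dominates \<open>exp ((1 - e) * g x)\<close> for nonnegative \<open>x\<close>, as a sum over thresholds: its
  moments, and the mixed moments of two of them, depend on the distribution only through the tails.
  The first threshold is \<open>- 1\<close>, so that \<open>x = 0\<close> is covered.\<close>

definition layers :: "(real \<Rightarrow> real) \<Rightarrow> real \<Rightarrow> real \<Rightarrow> ennreal" where
  "layers g e x = (\<Sum>n. ennreal (exp ((1 - e) * g (real n))) * indicator {real n - 1<..} x)"

lemma exp_le_layers:
  assumes "mono g" "e < 1" "0 \<le> x"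
  shows "ennreal (exp ((1 - e) * g x)) \<le> layers g e x"
proof -
  define n where "n = nat \<lceil>x\<rceil>"
  have n: "x \<le> real n" "real n - 1 < x" using assms unfolding n_def by linarith+
  have "exp ((1 - e) * g x) \<le> exp ((1 - e) * g (real n))"
    using assms n by (auto intro!: mult_left_mono dest: monoD)
  then have "ennreal (exp ((1 - e) * g x)) \<le> (\<Sum>i\<in>{n}. ennreal (exp ((1 - e) * g (real i))) * indicator {real i - 1<..} x)"
    using n by (simp add: ennreal_leI)
  also have "\<dots> \<le> layers g e x"
    unfolding layers_def by (intro sum_le_suminf) auto
  finally show ?thesis .
qed

text \<open>For large \<open>n\<close> regular variation gives \<open>g n \<le> (1 + e) * g (n - 1)\<close>, so the terms are at most
  \<open>exp (- e\<^sup>2 * g (n - 1))\<close>, which is below \<open>(n - 1) powr - 2\<close> as \<open>g\<close> outgrows every multiple of \<open>ln\<close>.\<close>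

lemma layers_summable:
  fixes g :: "real \<Rightarrow> real"
  assumes g: "varies_with_index \<rho> g" "\<And>x. g x \<ge> 0" "mono g" "\<rho> > 0" and e: "0 < e" "e < 1"
  shows "(\<Sum>n. ennreal (exp ((1 - e) * g (real n)) * exp (- g (real n - 1)))) < \<infinity>"
proof -
  have "((\<lambda>d. (1 + d) powr \<rho>) \<longlongrightarrow> (1 + 0) powr \<rho>) (at_right (0::real))"
    by (intro tendsto_intros) auto
  then have "\<forall>\<^sub>F d::real in at_right 0. (1 + d) powr \<rho> < 1 + e"
    using e by (intro order_tendstoD) auto
  moreover have "\<forall>\<^sub>F d::real in at_right 0. d > 0" by (simp add: eventually_at_filter)
  ultimately have "\<forall>\<^sub>F d::real in at_right 0. (1 + d) powr \<rho> < 1 + e \<and> d > 0" by eventually_elim auto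
  then obtain d :: real where d: "(1 + d) powr \<rho> < 1 + e" "d > 0"
    using eventually_happens'[OF trivial_limit_at_right_real] by blast
  have fl: "filterlim (\<lambda>n. real n - 1) at_top sequentially" by real_asymp
  have "\<forall>\<^sub>F x in at_top. g ((1 + d) * x) \<le> (1 + e) * g x"
    using d by (intro index_eventually_le[OF g(1,2)]) auto
  from eventually_compose_filterlim[OF this fl]
  have ev1: "\<forall>\<^sub>F n in sequentially. g ((1 + d) * (real n - 1)) \<le> (1 + e) * g (real n - 1)" .
  from eventually_compose_filterlim[OF index_dominates_ln[OF g, of "2 / e\<^sup>2"] fl]
  have ev2: "\<forall>\<^sub>F n in sequentially. 2 / e\<^sup>2 * ln (real n - 1) \<le> g (real n - 1)" .
  have ev3: "\<forall>\<^sub>F n in sequentially. real n \<le> (1 + d) * (real n - 1)" using d by real_asymp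
  have ev: "\<forall>\<^sub>F n in sequentially. norm (exp ((1 - e) * g (real n)) * exp (- g (real n - 1))) \<le> (real n - 1) powr (-2)"
    using ev1 ev2 ev3 eventually_gt_at_top[of 1]
  proof eventually_elim
    case (elim n)
    have "g (real n) \<le> (1 + e) * g (real n - 1)" using elim monoD[OF g(3) elim(3)] by linarith
    then have "(1 - e) * g (real n) \<le> (1 - e) * ((1 + e) * g (real n - 1))" using e by (intro mult_left_mono) auto
    then have "(1 - e) * g (real n) - g (real n - 1) \<le> - (e\<^sup>2 * g (real n - 1))"
      by (simp add: algebra_simps power2_eq_square)
    also have "\<dots> \<le> - (e\<^sup>2 * (2 / e\<^sup>2 * ln (real n - 1)))"
      using elim e by (intro le_imp_neg_le mult_left_mono) auto
    also have "\<dots> = -2 * ln (real n - 1)" using e by simp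
    finally have "exp ((1 - e) * g (real n) - g (real n - 1)) \<le> exp (-2 * ln (real n - 1))" by simp
    also have "\<dots> = (real n - 1) powr (-2)" using elim by (simp add: powr_def)
    finally show ?case by (simp add: mult_exp_exp)
  qed
  have "summable (\<lambda>n. exp ((1 - e) * g (real n)) * exp (- g (real n - 1)))"
  proof (rule summable_comparison_test_ev[OF ev])
    have "summable (\<lambda>n. (real (Suc n) - 1) powr (-2))"
      using summable_real_powr_iff[of "-2"] by simp
    then show "summable (\<lambda>n. (real n - 1) powr (-2))" by (rule summable_Suc_iff[THEN iffD1])
  qed
  then have "(\<Sum>n. ennreal (exp ((1 - e) * g (real n)) * exp (- g (real n - 1))))
     = ennreal (\<Sum>n. exp ((1 - e) * g (real n)) * exp (- g (real n - 1)))"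
    by (intro suminf_ennreal2) auto
  then show ?thesis by simp
qed

context prob_space
begin

lemma emeasure_tail:
  assumes "X \<in> borel_measurable M" "\<And>t. prob {\<omega> \<in> space M. X \<omega> > t} > 0"
  shows "(\<integral>\<^sup>+\<omega>. indicator {t<..} (X \<omega>) \<partial>M) = ennreal (exp (- tail_cost M X t))"
proof -
  have [measurable]: "X \<in> borel_measurable M" by fact
  have "(\<integral>\<^sup>+\<omega>. indicator {t<..} (X \<omega>) \<partial>M) = (\<integral>\<^sup>+\<omega>. indicator {\<omega> \<in> space M. X \<omega> > t} \<omega> \<partial>M)"
    by (intro nn_integral_cong) (auto simp: indicator_def)
  also have "\<dots> = emeasure M {\<omega> \<in> space M. X \<omega> > t}" by simp
  also have "\<dots> = ennreal (exp (- tail_cost M X t))"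
    unfolding emeasure_eq_measure exp_tail_cost[OF assms(2)] ..
  finally show ?thesis .
qed

lemma nn_integral_layers_finite:
  assumes [measurable]: "X \<in> borel_measurable M" and pos: "\<And>t. prob {\<omega> \<in> space M. X \<omega> > t} > 0"
    and vr: "varies_with_index \<rho> (tail_cost M X)" "\<rho> > 0" and e: "0 < e" "e < 1"
  shows "(\<integral>\<^sup>+\<omega>. layers (tail_cost M X) e (X \<omega>) \<partial>M) < \<infinity>"
proof -
  have "(\<integral>\<^sup>+\<omega>. layers (tail_cost M X) e (X \<omega>) \<partial>M)
     = (\<Sum>n. \<integral>\<^sup>+\<omega>. ennreal (exp ((1 - e) * tail_cost M X (real n))) * indicator {real n - 1<..} (X \<omega>) \<partial>M)"
    unfolding layers_def by (intro nn_integral_suminf) measurable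
  also have "\<dots> = (\<Sum>n. ennreal (exp ((1 - e) * tail_cost M X (real n)) * exp (- tail_cost M X (real n - 1))))"
    by (simp add: nn_integral_cmult emeasure_tail[OF assms(1) pos] ennreal_mult')
  also have "\<dots> < \<infinity>"
    by (rule layers_summable[OF vr(1) tail_cost_nonneg tail_cost_mono[OF assms(1) pos] vr(2) e])
  finally show ?thesis .
qed

text \<open>If the law of \<open>X\<close> is continuous, its tail cost evaluated at \<open>X\<close> is a standard exponential variable. An atom
  makes it larger, but by regular variation the tail cost just before and just after a large threshold
  differ by a factor close to 1, so that the exponential moments of order below 1 stay finite.\<close>

lemma nn_integral_exp_tail_cost_finite:
  assumes X: "X \<in> borel_measurable M" and pos: "\<And>t. prob {\<omega> \<in> space M. X \<omega> > t} > 0"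
    and nn: "AE \<omega> in M. 0 \<le> X \<omega>"
    and vr: "varies_with_index \<rho> (tail_cost M X)" "\<rho> > 0" and e: "0 < e" "e < 1"
  shows "(\<integral>\<^sup>+\<omega>. ennreal (exp ((1 - e) * tail_cost M X (X \<omega>))) \<partial>M) < \<infinity>"
proof -
  have "(\<integral>\<^sup>+\<omega>. ennreal (exp ((1 - e) * tail_cost M X (X \<omega>))) \<partial>M) \<le> (\<integral>\<^sup>+\<omega>. layers (tail_cost M X) e (X \<omega>) \<partial>M)"
    using nn by (intro nn_integral_mono_AE, eventually_elim) (intro exp_le_layers tail_cost_mono[OF X pos] e)
  also have "\<dots> < \<infinity>" by (rule nn_integral_layers_finite[OF X pos vr e])
  finally show ?thesis .
qed

text \<open>Expanding the product of the two sums of layers, negative dependence bounds each mixed term by the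
  product of the marginal ones, so that the mixed moment is at most a product of two finite moments.\<close>

lemma nn_integral_exp_tail_cost_product_finite:
  assumes X [measurable]: "X \<in> borel_measurable M" and posX: "\<And>t. prob {\<omega> \<in> space M. X \<omega> > t} > 0"
    and nnX: "AE \<omega> in M. 0 \<le> X \<omega>"
    and vrX: "varies_with_index \<rho> (tail_cost M X)" "\<rho> > 0"
    and Y [measurable]: "Y \<in> borel_measurable M" and posY: "\<And>t. prob {\<omega> \<in> space M. Y \<omega> > t} > 0"
    and nnY: "AE \<omega> in M. 0 \<le> Y \<omega>"
    and vrY: "varies_with_index \<sigma> (tail_cost M Y)" "\<sigma> > 0"
    and joint: "\<And>s t. prob {\<omega> \<in> space M. X \<omega> > s \<and> Y \<omega> > t}
        \<le> prob {\<omega> \<in> space M. X \<omega> > s} * prob {\<omega> \<in> space M. Y \<omega> > t}"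
    and e: "0 < e" "e < 1"
  shows "(\<integral>\<^sup>+\<omega>. ennreal (exp ((1 - e) * (tail_cost M X (X \<omega>) + tail_cost M Y (Y \<omega>)))) \<partial>M) < \<infinity>"
proof -
  define a where "a n = ennreal (exp ((1 - e) * tail_cost M X (real n)))" for n
  define b where "b n = ennreal (exp ((1 - e) * tail_cost M Y (real n)))" for n
  define A where "A n \<omega> = (indicator {real n - 1<..} (X \<omega>) :: ennreal)" for n \<omega>
  define B where "B n \<omega> = (indicator {real n - 1<..} (Y \<omega>) :: ennreal)" for n \<omega>
  have [measurable]: "A n \<in> borel_measurable M" "B n \<in> borel_measurable M" for n
    unfolding A_def B_def by measurable
  have AB: "(\<integral>\<^sup>+\<omega>. A n \<omega> * B l \<omega> \<partial>M) \<le> (\<integral>\<^sup>+\<omega>. A n \<omega> \<partial>M) * (\<integral>\<^sup>+\<omega>. B l \<omega> \<partial>M)" for n l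
  proof -
    have "(\<integral>\<^sup>+\<omega>. A n \<omega> * B l \<omega> \<partial>M)
        = (\<integral>\<^sup>+\<omega>. indicator {\<omega> \<in> space M. X \<omega> > real n - 1 \<and> Y \<omega> > real l - 1} \<omega> \<partial>M)"
      unfolding A_def B_def by (intro nn_integral_cong) (auto simp: indicator_def)
    also have "\<dots> = emeasure M {\<omega> \<in> space M. X \<omega> > real n - 1 \<and> Y \<omega> > real l - 1}" by simp
    also have "\<dots> \<le> ennreal (exp (- tail_cost M X (real n - 1)) * exp (- tail_cost M Y (real l - 1)))"
      using joint[of "real n - 1" "real l - 1"]
      unfolding emeasure_eq_measure exp_tail_cost[OF posX] exp_tail_cost[OF posY] by (rule ennreal_leI)
    also have "\<dots> = (\<integral>\<^sup>+\<omega>. A n \<omega> \<partial>M) * (\<integral>\<^sup>+\<omega>. B l \<omega> \<partial>M)"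
      unfolding A_def B_def emeasure_tail[OF X posX] emeasure_tail[OF Y posY] by (simp add: ennreal_mult')
    finally show ?thesis .
  qed
  have "(\<integral>\<^sup>+\<omega>. ennreal (exp ((1 - e) * (tail_cost M X (X \<omega>) + tail_cost M Y (Y \<omega>)))) \<partial>M)
    \<le> (\<integral>\<^sup>+\<omega>. layers (tail_cost M X) e (X \<omega>) * layers (tail_cost M Y) e (Y \<omega>) \<partial>M)"
    using nnX nnY
  proof (intro nn_integral_mono_AE, eventually_elim)
    case (elim \<omega>)
    have "ennreal (exp ((1 - e) * (tail_cost M X (X \<omega>) + tail_cost M Y (Y \<omega>))))
      = ennreal (exp ((1 - e) * tail_cost M X (X \<omega>))) * ennreal (exp ((1 - e) * tail_cost M Y (Y \<omega>)))"
      by (simp add: distrib_left exp_add ennreal_mult')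
    also have "\<dots> \<le> layers (tail_cost M X) e (X \<omega>) * layers (tail_cost M Y) e (Y \<omega>)"
      using elim e by (intro mult_mono exp_le_layers tail_cost_mono[OF X posX] tail_cost_mono[OF Y posY]) auto
    finally show ?case .
  qed
  also have "\<dots> = (\<integral>\<^sup>+\<omega>. (\<Sum>n. a n * A n \<omega>) * (\<Sum>l. b l * B l \<omega>) \<partial>M)"
    by (simp add: layers_def a_def b_def A_def B_def)
  also have "\<dots> = (\<integral>\<^sup>+\<omega>. (\<Sum>n. \<Sum>l. a n * (b l * (A n \<omega> * B l \<omega>))) \<partial>M)"
  proof (rule nn_integral_cong)
    fix \<omega>
    have "(\<Sum>n. a n * A n \<omega>) * (\<Sum>l. b l * B l \<omega>) = (\<Sum>n. \<Sum>l. (a n * A n \<omega>) * (b l * B l \<omega>))"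
      by (simp only: ennreal_suminf_multc ennreal_suminf_cmult)
    then show "(\<Sum>n. a n * A n \<omega>) * (\<Sum>l. b l * B l \<omega>) = (\<Sum>n. \<Sum>l. a n * (b l * (A n \<omega> * B l \<omega>)))"
      by (simp only: mult_ac)
  qed
  also have "\<dots> = (\<Sum>n. \<integral>\<^sup>+\<omega>. (\<Sum>l. a n * (b l * (A n \<omega> * B l \<omega>))) \<partial>M)"
    by (intro nn_integral_suminf) measurable
  also have "\<dots> = (\<Sum>n. \<Sum>l. \<integral>\<^sup>+\<omega>. a n * (b l * (A n \<omega> * B l \<omega>)) \<partial>M)"
    by (intro arg_cong[where f = suminf] ext nn_integral_suminf) measurable
  also have "\<dots> = (\<Sum>n. \<Sum>l. a n * (b l * (\<integral>\<^sup>+\<omega>. A n \<omega> * B l \<omega> \<partial>M)))"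
    by (simp add: nn_integral_cmult)
  also have "\<dots> \<le> (\<Sum>n. \<Sum>l. a n * (b l * ((\<integral>\<^sup>+\<omega>. A n \<omega> \<partial>M) * (\<integral>\<^sup>+\<omega>. B l \<omega> \<partial>M))))"
    by (intro suminf_le mult_left_mono AB) auto
  also have "\<dots> = (\<Sum>n. a n * (\<integral>\<^sup>+\<omega>. A n \<omega> \<partial>M)) * (\<Sum>l. b l * (\<integral>\<^sup>+\<omega>. B l \<omega> \<partial>M))"
  proof -
    have "(\<Sum>n. \<Sum>l. a n * (b l * ((\<integral>\<^sup>+\<omega>. A n \<omega> \<partial>M) * (\<integral>\<^sup>+\<omega>. B l \<omega> \<partial>M))))
        = (\<Sum>n. \<Sum>l. (a n * (\<integral>\<^sup>+\<omega>. A n \<omega> \<partial>M)) * (b l * (\<integral>\<^sup>+\<omega>. B l \<omega> \<partial>M)))"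
      by (simp only: mult_ac)
    then show ?thesis by (simp only: ennreal_suminf_multc ennreal_suminf_cmult)
  qed
  also have "\<dots> = (\<integral>\<^sup>+\<omega>. (\<Sum>n. a n * A n \<omega>) \<partial>M) * (\<integral>\<^sup>+\<omega>. (\<Sum>l. b l * B l \<omega>) \<partial>M)"
    by (simp add: nn_integral_suminf nn_integral_cmult)
  also have "\<dots> = (\<integral>\<^sup>+\<omega>. layers (tail_cost M X) e (X \<omega>) \<partial>M) * (\<integral>\<^sup>+\<omega>. layers (tail_cost M Y) e (Y \<omega>) \<partial>M)"
    by (simp add: layers_def a_def b_def A_def B_def)
  also have "\<dots> < \<infinity>"
    using nn_integral_layers_finite[OF X posX vrX e] nn_integral_layers_finite[OF Y posY vrY e]
    by (simp add: ennreal_mult_less_top)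
  finally show ?thesis .
qed

end

section \<open>Stationarity of a perpetuity\<close>

lemma perpetuity_expectation:
  fixes P :: "'a measure" and N :: "'b measure" and g :: "real \<Rightarrow> real"
  assumes perp: "perpetuity P M Q N R" and P: "prob_space P"
    and [measurable]: "M \<in> borel_measurable P" "Q \<in> borel_measurable P"
    and [measurable]: "g \<in> borel_measurable borel" and bdd: "\<And>x. \<bar>g x\<bar> \<le> K"
  shows "(\<integral>\<eta>. (\<integral>\<omega>. g (M \<omega> * R \<eta> + Q \<omega>) \<partial>P) \<partial>N) = (\<integral>\<eta>. g (R \<eta>) \<partial>N)"
    and "integrable N (\<lambda>\<eta>. \<integral>\<omega>. g (M \<omega> * R \<eta> + Q \<omega>) \<partial>P)"
    and "integrable N (\<lambda>\<eta>. g (R \<eta>))"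
    and "integrable P (\<lambda>\<omega>. g (M \<omega> * y + Q \<omega>))"
proof -
  have N: "prob_space N" and [measurable]: "R \<in> borel_measurable N"
    and eq: "distr N borel R = distr (P \<Otimes>\<^sub>M N) borel (\<lambda>(\<omega>, \<eta>). M \<omega> * R \<eta> + Q \<omega>)"
    using perp by (auto simp: perpetuity_def)
  interpret P: prob_space P by fact
  interpret N: prob_space N by fact
  interpret PN: pair_prob_space P N ..
  have int: "integrable (P \<Otimes>\<^sub>M N) (\<lambda>(\<omega>, \<eta>). g (M \<omega> * R \<eta> + Q \<omega>))"
    by (rule PN.integrable_const_bound[where B = K]) (use bdd in auto)
  have "(\<integral>\<eta>. g (R \<eta>) \<partial>N) = (\<integral>x. g x \<partial>distr N borel R)"
    by (simp add: integral_distr)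
  also have "\<dots> = (\<integral>z. g (case z of (\<omega>, \<eta>) \<Rightarrow> M \<omega> * R \<eta> + Q \<omega>) \<partial>(P \<Otimes>\<^sub>M N))"
    unfolding eq by (subst integral_distr) auto
  also have "\<dots> = (\<integral>(\<omega>, \<eta>). g (M \<omega> * R \<eta> + Q \<omega>) \<partial>(P \<Otimes>\<^sub>M N))"
    by (intro Bochner_Integration.integral_cong) auto
  also have "\<dots> = (\<integral>\<eta>. (\<integral>\<omega>. g (M \<omega> * R \<eta> + Q \<omega>) \<partial>P) \<partial>N)"
    using PN.integral_snd[OF int] by simp
  finally show "(\<integral>\<eta>. (\<integral>\<omega>. g (M \<omega> * R \<eta> + Q \<omega>) \<partial>P) \<partial>N) = (\<integral>\<eta>. g (R \<eta>) \<partial>N)" ..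
  show "integrable N (\<lambda>\<eta>. \<integral>\<omega>. g (M \<omega> * R \<eta> + Q \<omega>) \<partial>P)"
    using PN.integrable_snd[OF int] by simp
  show "integrable N (\<lambda>\<eta>. g (R \<eta>))"
    by (rule N.integrable_const_bound[where B = K]) (use bdd in auto)
  show "integrable P (\<lambda>\<omega>. g (M \<omega> * y + Q \<omega>))"
    by (rule P.integrable_const_bound[where B = K]) (use bdd in auto)
qed

lemma perpetuity_tail:
  fixes P :: "'a measure" and N :: "'b measure"
  assumes perp: "perpetuity P M Q N R" and P: "prob_space P"
    and [measurable]: "M \<in> borel_measurable P" "Q \<in> borel_measurable P"
  shows "measure N {\<eta> \<in> space N. R \<eta> > x}
    = measure (P \<Otimes>\<^sub>M N) {z \<in> space (P \<Otimes>\<^sub>M N). M (fst z) * R (snd z) + Q (fst z) > x}"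
proof -
  have [measurable]: "R \<in> borel_measurable N"
    and eq: "distr N borel R = distr (P \<Otimes>\<^sub>M N) borel (\<lambda>(\<omega>, \<eta>). M \<omega> * R \<eta> + Q \<omega>)"
    using perp by (auto simp: perpetuity_def)
  have "measure N {\<eta> \<in> space N. R \<eta> > x} = measure (distr N borel R) {x<..}"
    by (subst measure_distr) (auto intro!: arg_cong[where f = "measure N"])
  also have "\<dots> = measure (P \<Otimes>\<^sub>M N) {z \<in> space (P \<Otimes>\<^sub>M N). M (fst z) * R (snd z) + Q (fst z) > x}"
    unfolding eq by (subst measure_distr) (auto intro!: arg_cong[where f = "measure (P \<Otimes>\<^sub>M N)"])
  finally show ?thesis .
qed

lemma perpetuity_tail_ge_product:
  fixes P :: "'a measure" and N :: "'b measure"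
  assumes perp: "perpetuity P M Q N R" and P: "prob_space P"
    and [measurable]: "M \<in> borel_measurable P" "Q \<in> borel_measurable P"
    and [measurable]: "A \<in> sets P" "B \<in> sets N"
    and incl: "\<And>\<omega> \<eta>. \<omega> \<in> A \<Longrightarrow> \<eta> \<in> B \<Longrightarrow> M \<omega> * R \<eta> + Q \<omega> > x"
  shows "measure P A * measure N B \<le> measure N {\<eta> \<in> space N. R \<eta> > x}"
proof -
  have N: "prob_space N" and [measurable]: "R \<in> borel_measurable N"
    using perp by (auto simp: perpetuity_def)
  interpret P: prob_space P by fact
  interpret N: prob_space N by fact
  interpret PN: pair_prob_space P N ..
  have "measure P A * measure N B = measure (P \<Otimes>\<^sub>M N) (A \<times> B)"
    by (simp add: measure_def N.emeasure_pair_measure_Times enn2real_mult)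
  also have "\<dots> \<le> measure (P \<Otimes>\<^sub>M N) {z \<in> space (P \<Otimes>\<^sub>M N). M (fst z) * R (snd z) + Q (fst z) > x}"
  proof (rule PN.finite_measure_mono)
    show "A \<times> B \<subseteq> {z \<in> space (P \<Otimes>\<^sub>M N). M (fst z) * R (snd z) + Q (fst z) > x}"
      using incl sets.sets_into_space[OF \<open>A \<in> sets P\<close>] sets.sets_into_space[OF \<open>B \<in> sets N\<close>]
      by (auto simp: space_pair_measure)
  qed auto
  also have "\<dots> = measure N {\<eta> \<in> space N. R \<eta> > x}"
    by (rule perpetuity_tail[OF perp P, symmetric]) auto
  finally show ?thesis .
qed

text \<open>The bounded function \<open>\<phi>\<close> decreases with the negative part of its argument, and satisfies \<open>\<phi> y \<le> \<phi> (M * y + Q)\<close>, strictly for \<open>y < 0\<close> since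
  \<open>M < 1\<close>. Both sides have the same expectation at \<open>y = R\<close>, so \<open>R < 0\<close> has probability zero.\<close>

lemma perpetuity_nonneg:
  fixes P :: "'a measure" and N :: "'b measure"
  assumes perp: "perpetuity P M Q N R" and P: "prob_space P"
    and [measurable]: "M \<in> borel_measurable P" "Q \<in> borel_measurable P"
    and ae: "AE \<omega> in P. 0 \<le> M \<omega> \<and> M \<omega> < 1 \<and> 0 \<le> Q \<omega>"
  shows "AE \<eta> in N. 0 \<le> R \<eta>"
proof -
  have N: "prob_space N" and [measurable]: "R \<in> borel_measurable N"
    using perp by (auto simp: perpetuity_def)
  interpret P: prob_space P by fact
  interpret N: prob_space N by fact
  define \<phi> :: "real \<Rightarrow> real" where "\<phi> x = 1 / (1 + max 0 (- x))" for x
  have [measurable]: "\<phi> \<in> borel_measurable borel" unfolding \<phi>_def by measurable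
  have bdd: "\<bar>\<phi> x\<bar> \<le> 1" for x by (auto simp: \<phi>_def)
  have le: "\<phi> y \<le> \<phi> (\<mu> * y + q)" if "0 \<le> \<mu>" "\<mu> < 1" "0 \<le> q" for \<mu> q y
  proof -
    have "max 0 (- (\<mu> * y + q)) \<le> max 0 (- y)"
    proof (cases "y \<ge> 0")
      case True
      then have "0 \<le> \<mu> * y" using that by simp
      then show ?thesis using that by simp
    next
      case False
      then have "1 * y \<le> \<mu> * y" using that by (intro mult_right_mono_neg) auto
      then show ?thesis using that by simp
    qed
    then show ?thesis unfolding \<phi>_def by (intro divide_left_mono) (auto intro: mult_pos_pos add_pos_nonneg)
  qed
  have less: "\<phi> y < \<phi> (\<mu> * y + q)" if "0 \<le> \<mu>" "\<mu> < 1" "0 \<le> q" "y < 0" for \<mu> q y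
  proof -
    have "1 * y < \<mu> * y" using that by (intro mult_strict_right_mono_neg) auto
    then have "- (\<mu> * y + q) < - y" using that by linarith
    then have "max 0 (- (\<mu> * y + q)) < max 0 (- y)" using that by (simp only: max_less_iff_conj less_max_iff_disj) simp
    then show ?thesis unfolding \<phi>_def by (intro divide_strict_left_mono) (auto intro: mult_pos_pos add_pos_nonneg)
  qed
  define u where "u y = (\<integral>\<omega>. \<phi> (M \<omega> * y + Q \<omega>) - \<phi> y \<partial>P)" for y
  note E = perpetuity_expectation[where g = \<phi>, OF perp P assms(3,4) \<open>\<phi> \<in> borel_measurable borel\<close> bdd]
  have intP: "integrable P (\<lambda>\<omega>. \<phi> (M \<omega> * y + Q \<omega>) - \<phi> y)" for y
    using E(4)[of y] by simp
  have u: "u y = (\<integral>\<omega>. \<phi> (M \<omega> * y + Q \<omega>) \<partial>P) - \<phi> y" for y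
    unfolding u_def using E(4)[of y] by (simp add: P.prob_space)
  have u_nn: "0 \<le> u y" for y
    unfolding u_def by (rule integral_nonneg_AE) (use ae le in \<open>force\<close>)
  have u_pos: "u y \<noteq> 0" if "y < 0" for y
  proof
    assume "u y = 0"
    moreover have "AE \<omega> in P. 0 \<le> \<phi> (M \<omega> * y + Q \<omega>) - \<phi> y" using ae le by force
    ultimately have "AE \<omega> in P. \<phi> (M \<omega> * y + Q \<omega>) - \<phi> y = 0"
      unfolding u_def using integral_nonneg_eq_0_iff_AE[OF intP] by blast
    with ae have "AE \<omega> in P. False" by eventually_elim (use less that in force)
    then show False by simp
  qed
  have "integrable N (\<lambda>\<eta>. u (R \<eta>))" unfolding u using E(2,3) by simp
  moreover have "(\<integral>\<eta>. u (R \<eta>) \<partial>N) = 0" unfolding u using E(1,2,3) by simp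
  ultimately have "AE \<eta> in N. u (R \<eta>) = 0"
    using integral_nonneg_eq_0_iff_AE u_nn by blast
  then show ?thesis by eventually_elim (metis u_pos not_le)
qed

text \<open>Truncating \<open>v\<close> at level \<open>v z\<close> makes it integrable, and stationarity says that its expected one-step change at \<open>R\<close>
  vanishes. Beyond \<open>z\<close> the truncated function cannot grow, and below \<open>z\<close> the drift condition applies; this
  bounds the expectation of \<open>v R\<close> on \<open>R \<le> z\<close> by \<open>2 * b\<close> uniformly in \<open>z\<close>.\<close>

lemma perpetuity_lyapunov_bound:
  fixes P :: "'a measure" and N :: "'b measure" and v :: "real \<Rightarrow> real"
  assumes perp: "perpetuity P M Q N R" and P: "prob_space P"
    and [measurable]: "M \<in> borel_measurable P" "Q \<in> borel_measurable P"
    and R_nn: "AE \<eta> in N. 0 \<le> R \<eta>"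
    and v_mono: "mono v" and v_pos: "\<And>y. 0 \<le> v y" and b: "0 \<le> b"
    and int: "\<And>y. 0 \<le> y \<Longrightarrow> integrable P (\<lambda>\<omega>. v (M \<omega> * y + Q \<omega>))"
    and drift: "\<And>y. 0 \<le> y \<Longrightarrow> (\<integral>\<omega>. v (M \<omega> * y + Q \<omega>) \<partial>P) \<le> v y / 2 + b"
  shows "v x * measure N {\<eta> \<in> space N. R \<eta> > x} \<le> 2 * b"
proof -
  have N: "prob_space N" and [measurable]: "R \<in> borel_measurable N"
    using perp by (auto simp: perpetuity_def)
  interpret P: prob_space P by fact
  interpret N: prob_space N by fact
  have [measurable]: "v \<in> borel_measurable borel" by (rule borel_measurable_mono[OF v_mono])
  have trunc: "v x / 2 * N.prob {\<eta> \<in> space N. x < R \<eta> \<and> R \<eta> \<le> z} \<le> b" for z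
  proof -
    define g where "g y = v (min y z)" for y
    have [measurable]: "g \<in> borel_measurable borel" unfolding g_def by measurable
    have g_le: "g y \<le> v y" "g y \<le> v z" "0 \<le> g y" for y
      unfolding g_def using v_pos by (auto intro: monoD[OF v_mono])
    have bdd: "\<bar>g y\<bar> \<le> v z" for y using g_le by simp
    note E = perpetuity_expectation[where g = g, OF perp P assms(3,4) \<open>g \<in> borel_measurable borel\<close> bdd]
    define S where "S = {\<eta> \<in> space N. x < R \<eta> \<and> R \<eta> \<le> z}"
    have [measurable]: "S \<in> sets N" unfolding S_def by measurable
    have "AE \<eta> in N. v x / 2 * indicator S \<eta> - b \<le> g (R \<eta>) - (\<integral>\<omega>. g (M \<omega> * R \<eta> + Q \<omega>) \<partial>P)"
      using R_nn AE_space
    proof eventually_elim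
      case (elim \<eta>)
      show ?case
      proof (cases "R \<eta> \<le> z")
        case True
        have "(\<integral>\<omega>. g (M \<omega> * R \<eta> + Q \<omega>) \<partial>P) \<le> (\<integral>\<omega>. v (M \<omega> * R \<eta> + Q \<omega>) \<partial>P)"
          by (intro integral_mono E(4) int elim g_le)
        also have "\<dots> \<le> v (R \<eta>) / 2 + b" by (rule drift[OF elim(1)])
        finally have "v (R \<eta>) / 2 - b \<le> g (R \<eta>) - (\<integral>\<omega>. g (M \<omega> * R \<eta> + Q \<omega>) \<partial>P)"
          using True by (simp add: g_def)
        moreover have "v x / 2 * indicator S \<eta> \<le> v (R \<eta>) / 2"
          using v_pos monoD[OF v_mono] by (auto simp: S_def indicator_def)
        ultimately show ?thesis by linarith
      next
        case False
        have "(\<integral>\<omega>. g (M \<omega> * R \<eta> + Q \<omega>) \<partial>P) \<le> (\<integral>\<omega>. v z \<partial>P)"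
          by (intro integral_mono E(4) g_le) auto
        also have "\<dots> = g (R \<eta>)" using False by (simp add: g_def P.prob_space)
        finally show ?thesis using False b by (simp add: S_def)
      qed
    qed
    moreover have intS: "integrable N (\<lambda>\<eta>. v x / 2 * indicator S \<eta>)"
      by (rule N.integrable_const_bound[where B = "v x"]) (auto simp: indicator_def v_pos)
    ultimately have "(\<integral>\<eta>. v x / 2 * indicator S \<eta> - b \<partial>N) \<le> (\<integral>\<eta>. g (R \<eta>) - (\<integral>\<omega>. g (M \<omega> * R \<eta> + Q \<omega>) \<partial>P) \<partial>N)"
      by (intro integral_mono_AE Bochner_Integration.integrable_diff E(2,3)) auto
    also have "\<dots> = 0" using E(1,2,3) by simp
    finally have "(\<integral>\<eta>. v x / 2 * indicator S \<eta> - b \<partial>N) \<le> 0" .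
    moreover have "(\<integral>\<eta>. v x / 2 * indicator S \<eta> - b \<partial>N) = v x / 2 * N.prob S - b"
      using Bochner_Integration.integral_diff[OF intS, of "\<lambda>_. b"] by (simp add: N.prob_space)
    ultimately show ?thesis unfolding S_def[symmetric] by simp
  qed
  have "(\<lambda>n. N.prob {\<eta> \<in> space N. x < R \<eta> \<and> R \<eta> \<le> real n}) \<longlonglongrightarrow> N.prob (\<Union>n. {\<eta> \<in> space N. x < R \<eta> \<and> R \<eta> \<le> real n})"
    by (intro N.finite_Lim_measure_incseq) (auto simp: incseq_def)
  also have "(\<Union>n. {\<eta> \<in> space N. x < R \<eta> \<and> R \<eta> \<le> real n}) = {\<eta> \<in> space N. R \<eta> > x}"
    using real_arch_simple by auto
  finally have "(\<lambda>n. v x / 2 * N.prob {\<eta> \<in> space N. x < R \<eta> \<and> R \<eta> \<le> real n}) \<longlonglongrightarrow> v x / 2 * N.prob {\<eta> \<in> space N. R \<eta> > x}"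
    by (intro tendsto_intros)
  then have "v x / 2 * N.prob {\<eta> \<in> space N. R \<eta> > x} \<le> b"
    by (rule LIMSEQ_le_const2) (use trunc in auto)
  then show ?thesis by simp
qed

text \<open>The drift condition for \<open>exp ((1 - e) * V)\<close> and Markov's inequality give \<open>P (R > x) \<le> c * exp (- (1 - e) * V x)\<close>, and \<open>V\<close> is
  asymptotic to \<open>rate * h\<close>.\<close>

lemma (in regular_costs) perpetuity_tail_upper:
  fixes P :: "'a measure" and N :: "'b measure"
  assumes perp: "perpetuity P M Q N R" and P: "prob_space P"
    and [measurable]: "M \<in> borel_measurable P" "Q \<in> borel_measurable P"
    and ae: "AE \<omega> in P. 0 \<le> M \<omega> \<and> M \<omega> < 1 \<and> 0 \<le> Q \<omega>"
    and int: "\<And>e. 0 < e \<Longrightarrow> e < 1 \<Longrightarrow> integrable P (\<lambda>\<omega>. exp ((1 - e) * (m (1 / (1 - M \<omega>)) + k (Q \<omega>))))"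
    and pos: "\<And>x. measure N {\<eta> \<in> space N. R \<eta> > x} > 0"
    and B: "B < rate"
  shows "\<forall>\<^sub>F x in at_top. B * h x \<le> tail_cost N R x"
proof -
  interpret P: prob_space P by fact
  have "((\<lambda>e. (1 - e) * rate) \<longlongrightarrow> (1 - 0) * rate) (at_right (0::real))"
    by (intro tendsto_intros)
  then have "\<forall>\<^sub>F e::real in at_right 0. B < (1 - e) * rate"
    using B by (intro order_tendstoD) auto
  moreover have "\<forall>\<^sub>F e::real in at_right 0. e > 0" by (simp add: eventually_at_filter)
  moreover have "\<forall>\<^sub>F e::real in at_right 0. e < 1" by (rule eventually_at_rightI[of 0 1]) auto
  ultimately have "\<forall>\<^sub>F e::real in at_right 0. B < (1 - e) * rate \<and> e > 0 \<and> e < 1" by eventually_elim auto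
  then obtain e :: real where e: "B < (1 - e) * rate" "0 < e" "e < 1"
    using eventually_happens'[OF trivial_limit_at_right_real] by blast
  define v where "v y = exp ((1 - e) * V y)" for y
  have v_mono: "mono v"
    unfolding v_def mono_def using e monoD[OF V_mono] by (auto intro!: mult_left_mono)
  have [measurable]: "v \<in> borel_measurable borel" by (rule borel_measurable_mono[OF v_mono])
  obtain Y where Y: "\<And>y. y \<ge> Y \<Longrightarrow> integrable P (\<lambda>\<omega>. v (M \<omega> * y + Q \<omega>))"
      "\<And>y. y \<ge> Y \<Longrightarrow> (\<integral>\<omega>. v (M \<omega> * y + Q \<omega>) \<partial>P) \<le> v y / 2"
    using drift_to_half[OF P _ _ ae int e(2,3)] unfolding v_def by (auto simp: eventually_at_top_linorder)
  have v_le: "AE \<omega> in P. v (M \<omega> * y + Q \<omega>) \<le> v (M \<omega> * max y Y + Q \<omega>)" for y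
    using ae
  proof eventually_elim
    case (elim \<omega>)
    then have "M \<omega> * y \<le> M \<omega> * max y Y" by (intro mult_left_mono) auto
    then show ?case by (intro monoD[OF v_mono]) simp
  qed
  have v_pos: "0 \<le> v y" for y by (simp add: v_def)
  have int': "integrable P (\<lambda>\<omega>. v (M \<omega> * y + Q \<omega>))" for y
    by (rule Bochner_Integration.integrable_bound[OF Y(1)[of "max y Y"]])
       (use v_le[of y] v_pos in \<open>auto\<close>)
  have drift: "(\<integral>\<omega>. v (M \<omega> * y + Q \<omega>) \<partial>P) \<le> v y / 2 + v Y / 2" for y
  proof -
    have "(\<integral>\<omega>. v (M \<omega> * y + Q \<omega>) \<partial>P) \<le> (\<integral>\<omega>. v (M \<omega> * max y Y + Q \<omega>) \<partial>P)"
      by (rule integral_mono_AE[OF int' int' v_le])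
    also have "\<dots> \<le> v (max y Y) / 2" by (rule Y(2)) simp
    also have "\<dots> \<le> v y / 2 + v Y / 2" using v_pos[of y] v_pos[of Y] by (auto simp: max_def)
    finally show ?thesis .
  qed
  have R_nn: "AE \<eta> in N. 0 \<le> R \<eta>"
    by (rule perpetuity_nonneg[OF perp P _ _ ae]) auto
  have bound: "v x * measure N {\<eta> \<in> space N. R \<eta> > x} \<le> 2 * (v Y / 2)" for x
    by (rule perpetuity_lyapunov_bound[OF perp P _ _ R_nn v_mono v_pos _ int' drift]) (use v_pos in auto)
  have tail: "(1 - e) * V x - ln (v Y) \<le> tail_cost N R x" for x
  proof -
    have "ln (v x * measure N {\<eta> \<in> space N. R \<eta> > x}) \<le> ln (v Y)"
      using bound[of x] pos[of x] by (subst ln_le_cancel_iff) (auto simp: v_def)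
    also have "ln (v x * measure N {\<eta> \<in> space N. R \<eta> > x}) = (1 - e) * V x - tail_cost N R x"
      using pos[of x] by (subst ln_mult_pos) (auto simp: v_def tail_cost_def)
    finally show ?thesis by simp
  qed
  have "((\<lambda>x. (1 - e) * (V x / h x) - ln (v Y) / h x) \<longlongrightarrow> (1 - e) * rate - 0) at_top"
    by (intro tendsto_intros V_asymp tendsto_divide_0[OF tendsto_const] filterlim_at_top_imp_at_infinity[OF h_at_top])
  then have "\<forall>\<^sub>F x in at_top. B < (1 - e) * (V x / h x) - ln (v Y) / h x"
    using e by (intro order_tendstoD) auto
  then show ?thesis using h_eventually_pos
  proof eventually_elim
    case (elim x)
    then have "B < ((1 - e) * V x - ln (v Y)) / h x" by (simp add: diff_divide_distrib)
    then have "B * h x < (1 - e) * V x - ln (v Y)" using elim by (simp add: pos_less_divide_eq)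
    then show ?case using tail[of x] by simp
  qed
qed

text \<open>From \<open>R > y\<close>, \<open>M > 1 - 1 / t\<close> and \<open>Q > q\<close> it follows that \<open>M * R + Q > y + (q - y / t)\<close>. Hence the tail cost of \<open>R\<close> obeys the step
  inequality of \<open>cost_upper_bound_by_steps\<close>.\<close>

lemma (in regular_costs) perpetuity_tail_lower:
  fixes P :: "'a measure" and N :: "'b measure"
  assumes perp: "perpetuity P M Q N R" and P: "prob_space P"
    and [measurable]: "M \<in> borel_measurable P" "Q \<in> borel_measurable P"
    and joint: "\<And>t q. 1 \<le> t \<Longrightarrow> exp (- (m t + k q)) \<le> measure P {\<omega> \<in> space P. M \<omega> > 1 - 1 / t \<and> Q \<omega> > q}"
    and pos: "\<And>x. measure N {\<eta> \<in> space N. R \<eta> > x} > 0"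
    and B: "rate < B"
  shows "\<forall>\<^sub>F x in at_top. tail_cost N R x \<le> B * h x"
proof (rule cost_upper_bound_by_steps[OF _ _ B])
  have N: "prob_space N" and [measurable]: "R \<in> borel_measurable N"
    using perp by (auto simp: perpetuity_def)
  interpret N: prob_space N by fact
  show "mono (tail_cost N R)" by (rule N.tail_cost_mono) (use pos in auto)
  fix y t q :: real assume y: "0 \<le> y" and t: "1 \<le> t" and q: "0 \<le> q"
  define A where "A = {\<omega> \<in> space P. M \<omega> > 1 - 1 / t \<and> Q \<omega> > q}"
  define C where "C = {\<eta> \<in> space N. R \<eta> > y}"
  have [measurable]: "A \<in> sets P" "C \<in> sets N" unfolding A_def C_def by measurable
  have "exp (- (m t + k q)) * exp (- tail_cost N R y) \<le> measure P A * measure N C"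
    using joint[OF t, of q] N.exp_tail_cost[of R y] pos unfolding A_def C_def by (intro mult_mono) auto
  also have "\<dots> \<le> measure N {\<eta> \<in> space N. R \<eta> > y + (q - y / t)}"
  proof (rule perpetuity_tail_ge_product[OF perp P])
    fix \<omega> \<eta> assume "\<omega> \<in> A" "\<eta> \<in> C"
    then have "M \<omega> > 1 - 1 / t" "Q \<omega> > q" "R \<eta> > y" by (auto simp: A_def C_def)
    moreover from this have "(1 - 1 / t) * y \<le> M \<omega> * R \<eta>" using y t by (intro mult_mono) (auto intro: order_trans[of 0 "1 - 1 / t"])
    ultimately show "M \<omega> * R \<eta> + Q \<omega> > y + (q - y / t)" by (simp add: algebra_simps)
  qed auto
  also have "\<dots> = exp (- tail_cost N R (y + (q - y / t)))" by (rule N.exp_tail_cost) (use pos in auto)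
  finally show "tail_cost N R (y + (q - y / t)) \<le> tail_cost N R y + (m t + k q)"
    by (simp add: mult_exp_exp)
qed

section \<open>Thin-tailed perpetuities\<close>

lemma (in prob_space) prob_joint_tail:
  fixes X Y :: "'a \<Rightarrow> real"
  assumes [measurable]: "X \<in> borel_measurable M" "Y \<in> borel_measurable M"
  shows "prob {\<omega> \<in> space M. X \<omega> > x \<and> Y \<omega> > y} - prob {\<omega> \<in> space M. X \<omega> > x} * prob {\<omega> \<in> space M. Y \<omega> > y}
    = prob {\<omega> \<in> space M. X \<omega> \<le> x \<and> Y \<omega> \<le> y} - prob {\<omega> \<in> space M. X \<omega> \<le> x} * prob {\<omega> \<in> space M. Y \<omega> \<le> y}"
proof -
  define A where "A = {\<omega> \<in> space M. X \<omega> \<le> x}"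
  define B where "B = {\<omega> \<in> space M. Y \<omega> \<le> y}"
  have [measurable]: "A \<in> events" "B \<in> events" unfolding A_def B_def by measurable
  have "{\<omega> \<in> space M. X \<omega> > x} = space M - A" "{\<omega> \<in> space M. Y \<omega> > y} = space M - B"
    "{\<omega> \<in> space M. X \<omega> > x \<and> Y \<omega> > y} = space M - (A \<union> B)"
    "{\<omega> \<in> space M. X \<omega> \<le> x \<and> Y \<omega> \<le> y} = A \<inter> B"
    by (auto simp: A_def B_def)
  moreover have "prob (A \<union> B) = prob A + prob B - prob (A \<inter> B)"
    by (rule measure_Un3) (auto simp: fmeasurable_eq_sets)
  ultimately show ?thesis
    unfolding A_def[symmetric] B_def[symmetric] by (simp add: prob_compl algebra_simps)
qed

locale thin_tailed_perpetuity = prob_space P for P :: "'a measure" +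
  fixes M Q :: "'a \<Rightarrow> real" and N :: "'b measure" and R :: "'b \<Rightarrow> real" and \<alpha> r :: real
  assumes M_measurable [measurable]: "M \<in> borel_measurable P"
    and Q_measurable [measurable]: "Q \<in> borel_measurable P"
    and MQ_nonneg: "AE \<omega> in P. 0 \<le> M \<omega> \<and> 0 \<le> Q \<omega>"
    and \<alpha>: "\<alpha> > 1" and r: "r > 1"
    and Q_tail: "regularly_varying \<alpha> (\<lambda>x. - ln (prob {\<omega> \<in> space P. Q \<omega> > x}))"
    and M_tail: "regularly_varying r (\<lambda>x. - x * ln (prob {\<omega> \<in> space P. M \<omega> \<ge> 1 - 1 / x}))"
    and perp: "perpetuity P M Q N R"
begin

definition "T \<omega> = 1 / (1 - M \<omega>)"

abbreviation "m \<equiv> tail_cost P T"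
abbreviation "k \<equiv> tail_cost P Q"

lemma T_measurable [measurable]: "T \<in> borel_measurable P"
  unfolding T_def by measurable

lemma Q_tail_pos: "prob {\<omega> \<in> space P. Q \<omega> > x} > 0"
proof -
  obtain x0 where x0: "\<forall>x\<ge>x0. - ln (prob {\<omega> \<in> space P. Q \<omega> > x}) > 0"
    using Q_tail by (auto simp: regularly_varying_def)
  have "- ln (prob {\<omega> \<in> space P. Q \<omega> > max x x0}) > 0"
    using x0[rule_format, of "max x x0"] by simp
  then have "prob {\<omega> \<in> space P. Q \<omega> > max x x0} \<noteq> 0" by auto
  then have "0 < prob {\<omega> \<in> space P. Q \<omega> > max x x0}" by (simp add: less_le measure_nonneg)
  also have "\<dots> \<le> prob {\<omega> \<in> space P. Q \<omega> > x}" by (intro finite_measure_mono) auto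
  finally show ?thesis .
qed

lemma k_index: "varies_with_index \<alpha> k"
  using Q_tail by (simp add: regularly_varying_def varies_with_index_def tail_cost_def[abs_def])

text \<open>The argument is cut off at 1 so that the function is monotone and nonnegative on the whole line.\<close>

definition "M_cost x = - ln (prob {\<omega> \<in> space P. M \<omega> \<ge> 1 - 1 / max 1 x})"

lemma M_ge_pos: "y < 1 \<Longrightarrow> prob {\<omega> \<in> space P. M \<omega> \<ge> y} > 0"
proof -
  assume y: "y < 1"
  obtain x0 where x0: "\<forall>x\<ge>x0. - x * ln (prob {\<omega> \<in> space P. M \<omega> \<ge> 1 - 1 / x}) > 0"
    using M_tail by (auto simp: regularly_varying_def)
  define x where "x = max x0 (1 / (1 - y))"
  have "- x * ln (prob {\<omega> \<in> space P. M \<omega> \<ge> 1 - 1 / x}) > 0" using x0 by (simp add: x_def)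
  then have "prob {\<omega> \<in> space P. M \<omega> \<ge> 1 - 1 / x} \<noteq> 0" by auto
  then have "0 < prob {\<omega> \<in> space P. M \<omega> \<ge> 1 - 1 / x}" by (simp add: less_le measure_nonneg)
  also have "\<dots> \<le> prob {\<omega> \<in> space P. M \<omega> \<ge> y}"
  proof (rule finite_measure_mono)
    have "1 / (1 - y) \<le> x" by (simp add: x_def)
    moreover have "x > 0" using y by (simp add: x_def less_max_iff_disj)
    ultimately have "y \<le> 1 - 1 / x" using y by (simp add: field_simps)
    then show "{\<omega> \<in> space P. M \<omega> \<ge> 1 - 1 / x} \<subseteq> {\<omega> \<in> space P. M \<omega> \<ge> y}" by auto
  qed auto
  finally show ?thesis .
qed

lemma M_cost_nonneg: "0 \<le> M_cost x"
  unfolding M_cost_def using M_ge_pos[of "1 - 1 / max 1 x"] by (simp add: ln_le_zero_iff)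

lemma M_cost_mono: "mono M_cost"
proof (rule monoI)
  fix x y :: real assume "x \<le> y"
  then have "1 / max 1 y \<le> 1 / max 1 x" by (intro divide_left_mono) auto
  then have "prob {\<omega> \<in> space P. M \<omega> \<ge> 1 - 1 / max 1 y} \<le> prob {\<omega> \<in> space P. M \<omega> \<ge> 1 - 1 / max 1 x}"
    by (intro finite_measure_mono) auto
  then show "M_cost x \<le> M_cost y"
    unfolding M_cost_def using M_ge_pos[of "1 - 1 / max 1 y"] M_ge_pos[of "1 - 1 / max 1 x"] by simp
qed

lemma M_cost_index: "varies_with_index (r - 1) M_cost"
  unfolding varies_with_index_def
proof (intro allI impI)
  fix t :: real assume t: "t > 0"
  define f where "f x = - x * ln (prob {\<omega> \<in> space P. M \<omega> \<ge> 1 - 1 / x})" for x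
  have "((\<lambda>x. f (t * x) / f x) \<longlongrightarrow> t powr r) at_top"
    using M_tail t by (auto simp: regularly_varying_def f_def)
  then have "((\<lambda>x. f (t * x) / f x / t) \<longlongrightarrow> t powr r / t) at_top"
    using t by (intro tendsto_intros) auto
  moreover have "t powr r / t = t powr (r - 1)" using t by (simp add: powr_diff)
  moreover have "\<forall>\<^sub>F x in at_top. f (t * x) / f x / t = M_cost (t * x) / M_cost x"
    using eventually_ge_at_top[of 1] eventually_ge_at_top[of "1 / t"]
  proof eventually_elim
    case (elim x)
    then have "max 1 x = x" "max 1 (t * x) = t * x" using t by (auto simp: max_def field_simps)
    then show ?case using t elim by (simp add: f_def M_cost_def)
  qed
  ultimately show "((\<lambda>x. M_cost (t * x) / M_cost x) \<longlongrightarrow> t powr (r - 1)) at_top"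
    by (simp add: Lim_transform_eventually)
qed

lemma M_less_1: "AE \<omega> in P. M \<omega> < 1"
proof -
  have lim: "filterlim M_cost at_top at_top"
    using r by (intro index_at_top[OF M_cost_index M_cost_nonneg M_cost_mono]) auto
  have "((\<lambda>z::real. exp (- z)) \<longlongrightarrow> 0) at_top" by real_asymp
  from filterlim_compose[OF this lim] have "((\<lambda>x. exp (- M_cost x)) \<longlongrightarrow> 0) at_top" .
  moreover have "prob {\<omega> \<in> space P. M \<omega> \<ge> 1} \<le> exp (- M_cost x)" for x
  proof -
    have "prob {\<omega> \<in> space P. M \<omega> \<ge> 1} \<le> prob {\<omega> \<in> space P. M \<omega> \<ge> 1 - 1 / max 1 x}"
      by (intro finite_measure_mono) (auto intro: order_trans[rotated])
    also have "\<dots> = exp (- M_cost x)"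
      unfolding M_cost_def using M_ge_pos[of "1 - 1 / max 1 x"] by simp
    finally show ?thesis .
  qed
  ultimately have "prob {\<omega> \<in> space P. M \<omega> \<ge> 1} \<le> 0"
    by (intro tendsto_lowerbound[of "\<lambda>x. exp (- M_cost x)" 0 at_top]) auto
  then have "prob {\<omega> \<in> space P. M \<omega> \<ge> 1} = 0" by (simp add: measure_le_0_iff)
  then have "AE \<omega> in P. \<not> (\<omega> \<in> space P \<and> M \<omega> \<ge> 1)"
    by (subst AE_iff_measurable[of "{\<omega> \<in> space P. M \<omega> \<ge> 1}"]) (auto simp: emeasure_eq_measure)
  with AE_space show ?thesis by eventually_elim auto
qed

lemma MQ_range: "AE \<omega> in P. 0 \<le> M \<omega> \<and> M \<omega> < 1 \<and> 0 \<le> Q \<omega>"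
  using MQ_nonneg M_less_1 by eventually_elim auto

lemma T_gt_iff: "0 \<le> M \<omega> \<Longrightarrow> M \<omega> < 1 \<Longrightarrow> T \<omega> > t \<longleftrightarrow> M \<omega> > (if t < 1 then -1 else 1 - 1 / t)"
proof (cases "t < 1")
  case True
  assume M: "0 \<le> M \<omega>" "M \<omega> < 1"
  then have "1 \<le> T \<omega>" by (simp add: T_def)
  with True M show ?thesis by simp
next
  case False
  assume "0 \<le> M \<omega>" "M \<omega> < 1"
  with False show ?thesis unfolding T_def by (simp add: field_simps)
qed

lemma prob_T_gt:
  "prob {\<omega> \<in> space P. T \<omega> > t \<and> Q \<omega> > q} = prob {\<omega> \<in> space P. M \<omega> > (if t < 1 then -1 else 1 - 1 / t) \<and> Q \<omega> > q}"
  "prob {\<omega> \<in> space P. T \<omega> > t} = prob {\<omega> \<in> space P. M \<omega> > (if t < 1 then -1 else 1 - 1 / t)}"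
proof -
  note [measurable] = T_measurable
  have "AE \<omega> in P. T \<omega> > t \<longleftrightarrow> M \<omega> > (if t < 1 then -1 else 1 - 1 / t)"
    using MQ_range by eventually_elim (rule T_gt_iff; blast)
  then show "prob {\<omega> \<in> space P. T \<omega> > t \<and> Q \<omega> > q} = prob {\<omega> \<in> space P. M \<omega> > (if t < 1 then -1 else 1 - 1 / t) \<and> Q \<omega> > q}"
    "prob {\<omega> \<in> space P. T \<omega> > t} = prob {\<omega> \<in> space P. M \<omega> > (if t < 1 then -1 else 1 - 1 / t)}"
    by (auto intro!: finite_measure_eq_AE elim!: eventually_mono simp del: not_less)
qed

lemma T_tail_ge: "1 \<le> t \<Longrightarrow> 1 < c \<Longrightarrow> exp (- M_cost (c * t)) \<le> prob {\<omega> \<in> space P. T \<omega> > t}"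
proof -
  assume t: "1 \<le> t" "1 < c"
  have ct: "t < c * t" using t by simp
  then have ct': "max 1 (c * t) = c * t" using t by linarith
  have "exp (- M_cost (c * t)) = prob {\<omega> \<in> space P. M \<omega> \<ge> 1 - 1 / (c * t)}"
    unfolding M_cost_def ct' using M_ge_pos[of "1 - 1 / (c * t)"] t ct by simp
  also have "\<dots> \<le> prob {\<omega> \<in> space P. M \<omega> > 1 - 1 / t}"
  proof (intro finite_measure_mono)
    have "1 / (c * t) < 1 / t" using t ct by (intro divide_strict_left_mono) auto
    then show "{\<omega> \<in> space P. M \<omega> \<ge> 1 - 1 / (c * t)} \<subseteq> {\<omega> \<in> space P. M \<omega> > 1 - 1 / t}" by auto
  qed auto
  also have "\<dots> = prob {\<omega> \<in> space P. T \<omega> > t}" using prob_T_gt(2)[of t] t by simp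
  finally show ?thesis .
qed

lemma T_tail_pos: "prob {\<omega> \<in> space P. T \<omega> > t} > 0"
proof -
  have "0 < exp (- M_cost (2 * max 1 t))" by simp
  also have "\<dots> \<le> prob {\<omega> \<in> space P. T \<omega> > max 1 t}" by (rule T_tail_ge) auto
  also have "\<dots> \<le> prob {\<omega> \<in> space P. T \<omega> > t}" by (intro finite_measure_mono) auto
  finally show ?thesis .
qed

lemma m_index: "varies_with_index (r - 1) m"
proof (rule index_squeeze[OF M_cost_index M_cost_nonneg])
  show "\<forall>\<^sub>F t in at_top. M_cost t \<le> m t"
    using eventually_ge_at_top[of 1]
  proof eventually_elim
    case (elim t)
    have "prob {\<omega> \<in> space P. T \<omega> > t} = prob {\<omega> \<in> space P. M \<omega> > 1 - 1 / t}"
      using prob_T_gt(2)[of t] elim by simp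
    also have "\<dots> \<le> prob {\<omega> \<in> space P. M \<omega> \<ge> 1 - 1 / max 1 t}"
      using elim by (intro finite_measure_mono) auto
    finally show ?case
      using T_tail_pos[of t] M_ge_pos[of "1 - 1 / max 1 t"] by (simp add: tail_cost_def M_cost_def)
  qed
  show "\<forall>\<^sub>F t in at_top. m t \<le> M_cost (c * t)" if "c > 1" for c
    using eventually_ge_at_top[of 1]
  proof eventually_elim
    case (elim t)
    show ?case using T_tail_ge[OF elim that] exp_tail_cost[of T t] T_tail_pos by simp
  qed
qed

sublocale costs: regular_costs m k \<alpha> r
  using tail_cost_mono[OF T_measurable T_tail_pos] tail_cost_mono[OF Q_measurable Q_tail_pos]
  by unfold_locales (auto intro: tail_cost_nonneg m_index k_index \<alpha> r)

lemma h_ind_eq: "h_ind P M Q x = perp_cost m k x"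
  unfolding h_ind_def perp_cost_def
proof (rule INF_cong)
  fix t :: real
  have "- t * ln (prob {\<omega> \<in> space P. 1 / (1 - M \<omega>) > t} * prob {\<omega> \<in> space P. Q \<omega> > x / t})
      = - t * (ln (prob {\<omega> \<in> space P. T \<omega> > t}) + ln (prob {\<omega> \<in> space P. Q \<omega> > x / t}))"
    using T_tail_pos[of t] Q_tail_pos[of "x / t"] by (simp add: ln_mult_pos T_def)
  then show "- t * ln (prob {\<omega> \<in> space P. 1 / (1 - M \<omega>) > t} * prob {\<omega> \<in> space P. Q \<omega> > x / t})
      = t * (m t + k (x / t))"
    by (simp add: tail_cost_def algebra_simps)
qed simp

lemma R_tail_pos: "measure N {\<eta> \<in> space N. R \<eta> > x} > 0"
proof -
  have N: "prob_space N" and [measurable]: "R \<in> borel_measurable N"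
    using perp by (auto simp: perpetuity_def)
  interpret N: prob_space N by fact
  define A where "A = {\<omega> \<in> space P. 0 \<le> M \<omega> \<and> Q \<omega> > x}"
  define B where "B = {\<eta> \<in> space N. 0 \<le> R \<eta>}"
  have [measurable]: "A \<in> sets P" "B \<in> sets N" unfolding A_def B_def by measurable
  have "AE \<eta> in N. \<eta> \<in> B"
    using perpetuity_nonneg[OF perp prob_space_axioms M_measurable Q_measurable MQ_range] AE_space
    by eventually_elim (simp add: B_def)
  then have B: "measure N B = 1" by (simp add: N.prob_eq_1)
  have "prob A = prob {\<omega> \<in> space P. Q \<omega> > x}"
  proof (rule finite_measure_eq_AE)
    show "AE \<omega> in P. \<omega> \<in> A \<longleftrightarrow> \<omega> \<in> {\<omega> \<in> space P. Q \<omega> > x}"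
      using MQ_range by eventually_elim (simp add: A_def)
  qed auto
  then have "0 < prob A" using Q_tail_pos by simp
  also have "prob A = prob A * measure N B" by (simp add: B)
  also have "\<dots> \<le> measure N {\<eta> \<in> space N. R \<eta> > x}"
  proof (rule perpetuity_tail_ge_product[OF perp prob_space_axioms])
    fix \<omega> \<eta> assume "\<omega> \<in> A" "\<eta> \<in> B"
    then have "0 \<le> M \<omega> * R \<eta>" "x < Q \<omega>" by (auto simp: A_def B_def)
    then show "x < M \<omega> * R \<eta> + Q \<omega>" by simp
  qed auto
  finally show ?thesis .
qed

lemma exponentially_integrable_if_NQD:
  assumes nqd: "neg_quadrant_dependent P M Q" and e: "0 < e" "e < 1"
  shows "integrable P (\<lambda>\<omega>. exp ((1 - e) * (m (1 / (1 - M \<omega>)) + k (Q \<omega>))))"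
proof (rule integrableI_nonneg)
  have [measurable]: "m \<in> borel_measurable borel" "k \<in> borel_measurable borel"
    using costs.m_mono costs.k_mono by (auto intro: borel_measurable_mono)
  show "(\<lambda>\<omega>. exp ((1 - e) * (m (1 / (1 - M \<omega>)) + k (Q \<omega>)))) \<in> borel_measurable P" by measurable
  have joint: "prob {\<omega> \<in> space P. T \<omega> > s \<and> Q \<omega> > t} \<le> prob {\<omega> \<in> space P. T \<omega> > s} * prob {\<omega> \<in> space P. Q \<omega> > t}" for s t
    using prob_joint_tail[OF M_measurable Q_measurable, of "if s < 1 then -1 else 1 - 1 / s" t]
      nqd[unfolded neg_quadrant_dependent_def, rule_format, of "if s < 1 then -1 else 1 - 1 / s" t]
    unfolding prob_T_gt by linarith
  have "(\<integral>\<^sup>+\<omega>. ennreal (exp ((1 - e) * (m (T \<omega>) + k (Q \<omega>)))) \<partial>P) < \<infinity>"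
  proof (rule nn_integral_exp_tail_cost_product_finite[OF T_measurable T_tail_pos _ m_index _ Q_measurable Q_tail_pos _ k_index _ joint e])
    show "AE \<omega> in P. 0 \<le> T \<omega>" "AE \<omega> in P. 0 \<le> Q \<omega>"
      using MQ_range by (eventually_elim, simp add: T_def)+
  qed (use \<alpha> r in auto)
  then show "(\<integral>\<^sup>+\<omega>. ennreal (exp ((1 - e) * (m (1 / (1 - M \<omega>)) + k (Q \<omega>)))) \<partial>P) < \<infinity>"
    by (simp add: T_def)
qed simp

text \<open>A convex combination is at most the maximum, so that two marginal moments suffice, whatever the joint law.\<close>

lemma exponentially_integrable_weighted:
  assumes ab: "0 < a" "0 < b" "a + b = 1" and e: "0 < e" "e < 1"
  shows "integrable P (\<lambda>\<omega>. exp ((1 - e) * (a * m (1 / (1 - M \<omega>)) + b * k (Q \<omega>))))"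
proof (rule integrableI_nonneg)
  have [measurable]: "m \<in> borel_measurable borel" "k \<in> borel_measurable borel"
    using costs.m_mono costs.k_mono by (auto intro: borel_measurable_mono)
  show "(\<lambda>\<omega>. exp ((1 - e) * (a * m (1 / (1 - M \<omega>)) + b * k (Q \<omega>)))) \<in> borel_measurable P" by measurable
  have le: "exp ((1 - e) * (a * u + b * v)) \<le> exp ((1 - e) * u) + exp ((1 - e) * v)" for u v
  proof -
    have "a * u + b * v \<le> a * max u v + b * max u v" using ab by (intro add_mono mult_left_mono) auto
    also have "\<dots> = max u v" using ab by (simp flip: distrib_right)
    finally have "(1 - e) * (a * u + b * v) \<le> (1 - e) * max u v" using e by (intro mult_left_mono) auto
    then have "exp ((1 - e) * (a * u + b * v)) \<le> exp ((1 - e) * max u v)" by simp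
    also have "\<dots> \<le> exp ((1 - e) * u) + exp ((1 - e) * v)"
      by (cases "u \<le> v") (auto simp: max_def)
    finally show ?thesis .
  qed
  have nn: "AE \<omega> in P. 0 \<le> T \<omega>" "AE \<omega> in P. 0 \<le> Q \<omega>"
    using MQ_range by (eventually_elim, simp add: T_def)+
  have "(\<integral>\<^sup>+\<omega>. ennreal (exp ((1 - e) * (a * m (T \<omega>) + b * k (Q \<omega>)))) \<partial>P)
      \<le> (\<integral>\<^sup>+\<omega>. ennreal (exp ((1 - e) * m (T \<omega>))) + ennreal (exp ((1 - e) * k (Q \<omega>))) \<partial>P)"
    using le by (intro nn_integral_mono) (simp flip: ennreal_plus add: ennreal_leI)
  also have "\<dots> = (\<integral>\<^sup>+\<omega>. ennreal (exp ((1 - e) * m (T \<omega>))) \<partial>P) + (\<integral>\<^sup>+\<omega>. ennreal (exp ((1 - e) * k (Q \<omega>))) \<partial>P)"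
    by (intro nn_integral_add) measurable
  also have "\<dots> < \<infinity>"
    using nn_integral_exp_tail_cost_finite[OF T_measurable T_tail_pos nn(1) m_index _ e]
      nn_integral_exp_tail_cost_finite[OF Q_measurable Q_tail_pos nn(2) k_index _ e] \<alpha> r by simp
  finally show "(\<integral>\<^sup>+\<omega>. ennreal (exp ((1 - e) * (a * m (1 / (1 - M \<omega>)) + b * k (Q \<omega>)))) \<partial>P) < \<infinity>"
    by (simp add: T_def)
qed simp

lemma tail_upper_if_NQD:
  assumes "neg_quadrant_dependent P M Q" "B < costs.rate"
  shows "\<forall>\<^sub>F x in at_top. B * perp_cost m k x \<le> tail_cost N R x"
  by (rule costs.perpetuity_tail_upper[OF perp prob_space_axioms M_measurable Q_measurable MQ_range
        exponentially_integrable_if_NQD[OF assms(1)] R_tail_pos assms(2)])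

lemma tail_lower_if_PQD:
  assumes pqd: "pos_quadrant_dependent P M Q" and B: "costs.rate < B"
  shows "\<forall>\<^sub>F x in at_top. tail_cost N R x \<le> B * perp_cost m k x"
proof (rule costs.perpetuity_tail_lower[OF perp prob_space_axioms M_measurable Q_measurable _ R_tail_pos B])
  fix t q :: real assume t: "1 \<le> t"
  have "exp (- (m t + k q)) = prob {\<omega> \<in> space P. T \<omega> > t} * prob {\<omega> \<in> space P. Q \<omega> > q}"
    unfolding exp_tail_cost[of T, OF T_tail_pos] exp_tail_cost[of Q, OF Q_tail_pos] by (simp add: mult_exp_exp)
  also have "\<dots> = prob {\<omega> \<in> space P. M \<omega> > 1 - 1 / t} * prob {\<omega> \<in> space P. Q \<omega> > q}"
    using t by (simp add: prob_T_gt)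
  also have "\<dots> \<le> prob {\<omega> \<in> space P. M \<omega> > 1 - 1 / t \<and> Q \<omega> > q}"
    using prob_joint_tail[OF M_measurable Q_measurable, of "1 - 1 / t" q]
      pqd[unfolded pos_quadrant_dependent_def, rule_format, of "1 - 1 / t" q] by linarith
  finally show "exp (- (m t + k q)) \<le> prob {\<omega> \<in> space P. M \<omega> > 1 - 1 / t \<and> Q \<omega> > q}" .
qed

text \<open>A joint tail is bounded by each marginal one, hence the joint cost is at least the maximum of \<open>m\<close> and \<open>k\<close>,
  and so at least \<open>a * m + b * k\<close> whenever \<open>a + b = 1\<close>. The weights below are those for which the resulting
  constant \<open>a * (b / a) powr (r / (\<alpha> + r - 1))\<close> is largest.\<close>

lemma tail_upper_any_dependence:
  assumes C: "C < (\<alpha> - 1) / (\<alpha> + r - 1) * (r / (\<alpha> - 1)) powr (r / (\<alpha> + r - 1)) * costs.rate"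
  shows "\<forall>\<^sub>F x in at_top. C * perp_cost m k x \<le> tail_cost N R x"
proof (cases "C \<le> 0")
  case True
  have N: "prob_space N" using perp by (auto simp: perpetuity_def)
  interpret N: prob_space N by fact
  have "C * perp_cost m k x \<le> tail_cost N R x" for x
    using True costs.h_nonneg[of x] N.tail_cost_nonneg[of R x] by (smt (verit) mult_nonpos_nonneg)
  then show ?thesis by simp
next
  case False
  define a b where "a = (\<alpha> - 1) / (\<alpha> + r - 1)" and "b = r / (\<alpha> + r - 1)"
  have ab: "a > 0" "b > 0" using \<alpha> r by (auto simp: a_def b_def)
  have ab1: "a + b = 1" using \<alpha> r by (simp add: a_def b_def flip: add_divide_distrib)
  have ba: "b / a = r / (\<alpha> - 1)" using \<alpha> r by (simp add: a_def b_def)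
  define \<kappa> where "\<kappa> = a * (b / a) powr (r / (\<alpha> + r - 1))"
  have \<kappa>: "\<kappa> > 0" using ab by (simp add: \<kappa>_def)
  have "C < \<kappa> * costs.rate" using C by (simp add: \<kappa>_def ba) (simp add: a_def)
  then have "C / \<kappa> < costs.rate" using \<kappa> by (simp add: field_simps)
  then obtain B where B: "C / \<kappa> < B" "B < costs.rate" using dense by blast
  have "0 < C / \<kappa>" using False \<kappa> by simp
  then have Bpos: "B > 0" using B by simp
  interpret w: regular_costs "\<lambda>t. a * m t" "\<lambda>q. b * k q" \<alpha> r
    by (rule costs.weighted_regular_costs[OF ab])
  have "\<forall>\<^sub>F x in at_top. B * w.h x \<le> tail_cost N R x"
    by (rule w.perpetuity_tail_upper[OF perp prob_space_axioms M_measurable Q_measurable MQ_range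
          exponentially_integrable_weighted[OF ab ab1] R_tail_pos B(2)])
  moreover have "\<forall>\<^sub>F x in at_top. costs.h x \<le> B / C * w.h x"
    using B False \<kappa> unfolding \<kappa>_def
    by (intro costs.cost_le_weighted_cost ab) (simp add: field_simps)
  ultimately show ?thesis
  proof eventually_elim
    case (elim x)
    have "C * costs.h x \<le> C * (B / C * w.h x)" using elim False by (intro mult_left_mono) auto
    also have "\<dots> = B * w.h x" using False by simp
    finally show ?case using elim by simp
  qed
qed

end

lemma Limsup_neg_ratio_le:
  fixes h g :: "real \<Rightarrow> real"
  assumes "\<forall>\<^sub>F x in F. h x > 0" "\<And>B. B < c \<Longrightarrow> \<forall>\<^sub>F x in F. B * h x \<le> - g x"
  shows "Limsup F (\<lambda>x. ereal (g x / h x)) \<le> ereal (- c)"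
proof (rule ereal_le_epsilon2)
  fix e :: real assume "0 < e"
  then have "\<forall>\<^sub>F x in F. (c - e) * h x \<le> - g x" by (intro assms) simp
  with assms(1) have "\<forall>\<^sub>F x in F. ereal (g x / h x) \<le> ereal (- c + e)"
    by eventually_elim (simp add: field_simps)
  then show "Limsup F (\<lambda>x. ereal (g x / h x)) \<le> ereal (- c) + ereal e"
    by (simp add: Limsup_bounded)
qed

lemma Liminf_neg_ratio_ge:
  fixes h g :: "real \<Rightarrow> real"
  assumes "\<forall>\<^sub>F x in F. h x > 0" "\<And>B. c < B \<Longrightarrow> \<forall>\<^sub>F x in F. - g x \<le> B * h x"
  shows "ereal (- c) \<le> Liminf F (\<lambda>x. ereal (g x / h x))"
proof (rule ereal_le_epsilon2)
  fix e :: real assume "0 < e"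
  then have "\<forall>\<^sub>F x in F. - g x \<le> (c + e) * h x" by (intro assms) simp
  with assms(1) have "\<forall>\<^sub>F x in F. ereal (- c - e) \<le> ereal (g x / h x)"
    by eventually_elim (simp add: field_simps)
  then have "ereal (- c - e) \<le> Liminf F (\<lambda>x. ereal (g x / h x))"
    by (rule Liminf_bounded)
  then have "ereal (- c - e) + ereal e \<le> Liminf F (\<lambda>x. ereal (g x / h x)) + ereal e"
    by (rule add_right_mono)
  then show "ereal (- c) \<le> Liminf F (\<lambda>x. ereal (g x / h x)) + ereal e" by simp
qed

theorem theorem6p2:
  fixes P :: "'a measure" and M Q :: "'a \<Rightarrow> real"
    and N :: "'b measure" and R :: "'b \<Rightarrow> real"
    and \<alpha> r rstar \<beta> \<gamma> :: real
  assumes "prob_space P"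
    and "M \<in> borel_measurable P" and "Q \<in> borel_measurable P"
    and "\<P>(\<omega> in P. M \<omega> \<ge> 0 \<and> Q \<omega> \<ge> 0) = 1"
    and "\<alpha> > 1" and "r > 1"
    and "regularly_varying \<alpha> (\<lambda>x. - ln \<P>(\<omega> in P. Q \<omega> > x))"
    and "regularly_varying r (\<lambda>x. - x * ln \<P>(\<omega> in P. M \<omega> \<ge> 1 - 1 / x))"
    and "1 / r + 1 / rstar = 1" and "1 / \<alpha> + 1 / \<beta> = 1"
    and "\<gamma> = \<beta> * rstar / (\<beta> * rstar - 1)"
    and "perpetuity P M Q N R"
  shows
    "(neg_quadrant_dependent P M Q \<longrightarrow>
       Limsup at_top (\<lambda>x::real. ereal (ln \<P>(\<eta> in N. R \<eta> > x) / h_ind P M Q x))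
         \<le> ereal (- ((\<gamma> / (\<gamma> - 1)) powr (\<gamma> - 1)))) \<and>
     (pos_quadrant_dependent P M Q \<longrightarrow>
       ereal (- ((\<gamma> / (\<gamma> - 1)) powr (\<gamma> - 1)))
         \<le> Liminf at_top (\<lambda>x::real. ereal (ln \<P>(\<eta> in N. R \<eta> > x) / h_ind P M Q x)) \<and>
       Liminf at_top (\<lambda>x::real. ereal (ln \<P>(\<eta> in N. R \<eta> > x) / h_ind P M Q x))
         \<le> Limsup at_top (\<lambda>x::real. ereal (ln \<P>(\<eta> in N. R \<eta> > x) / h_ind P M Q x)) \<and>
       Limsup at_top (\<lambda>x::real. ereal (ln \<P>(\<eta> in N. R \<eta> > x) / h_ind P M Q x))
         \<le> ereal (- ((\<alpha> - 1) / (\<alpha> + r - 1) * (r / (\<alpha> - 1)) powr (r / (\<alpha> + r - 1))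
                    * (\<gamma> / (\<gamma> - 1)) powr (\<gamma> - 1))))"
proof -
  interpret prob_space P by fact
  note [measurable] = assms(2,3)
  have "AE \<omega> in P. \<omega> \<in> {\<omega> \<in> space P. 0 \<le> M \<omega> \<and> 0 \<le> Q \<omega>}"
    using assms(4) by (subst (asm) prob_eq_1) auto
  then have nn: "AE \<omega> in P. 0 \<le> M \<omega> \<and> 0 \<le> Q \<omega>" by eventually_elim auto
  interpret thin_tailed_perpetuity P M Q N R \<alpha> r
    by unfold_locales (fact assms nn)+
  have conj: "y = x / (x - 1)" if "1 < x" "1 / x + 1 / y = 1" for x y :: real
  proof -
    have "1 / y = (x - 1) / x" using that by (simp add: diff_divide_distrib)
    then have "1 / (1 / y) = 1 / ((x - 1) / x)" by (rule arg_cong)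
    then show ?thesis by simp
  qed
  have "rstar = r / (r - 1)" "\<beta> = \<alpha> / (\<alpha> - 1)"
    using assms(5,6,9,10) by (auto intro: conj)
  then have prod: "\<beta> * rstar = \<alpha> * r / ((\<alpha> - 1) * (r - 1))" by simp
  have d: "(\<alpha> - 1) * (r - 1) \<noteq> 0" using assms(5,6) by simp
  then have "\<beta> * rstar - 1 = (\<alpha> * r - (\<alpha> - 1) * (r - 1)) / ((\<alpha> - 1) * (r - 1))"
    unfolding prod by (simp add: diff_divide_distrib)
  also have "\<alpha> * r - (\<alpha> - 1) * (r - 1) = \<alpha> + r - 1" by (simp add: algebra_simps)
  finally have "\<gamma> = costs.\<gamma>"
    using d unfolding assms(11) costs.\<gamma>_def prod by simp
  then have rate: "(\<gamma> / (\<gamma> - 1)) powr (\<gamma> - 1) = costs.rate" by (simp add: costs.rate_def)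
  have tail: "ln \<P>(\<eta> in N. R \<eta> > x) = - tail_cost N R x" for x by (simp add: tail_cost_def)
  show ?thesis
    unfolding rate tail h_ind_eq
    by (intro conjI impI Limsup_neg_ratio_le Liminf_neg_ratio_ge costs.h_eventually_pos
        Liminf_le_Limsup trivial_limit_at_top_linorder)
       (simp_all add: tail_upper_if_NQD tail_lower_if_PQD tail_upper_any_dependence)
qed

end
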